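(* Let $X$ be a branched affine surface. Any two distinct hyperbolic cylinders in $X$, each of angle at least $\frac{\pi}{2}$, are disjoint.
   Context: A branched affine surface is a compact orientable topological surface $X$ with a nonempty finite set $\Lambda$ of marked points, together with an atlas of charts of $X\setminus\Lambda$ to $\mathbb{C}$ whose transition maps are affine maps $x\mapsto ax+b$ with $a\in\mathbb{C}^*$, $b\in\mathbb{C}$, such that every marked point is a conical singularity. A conical singularity of angle $\theta>0$ and dilation ratio $\lambda>0$ is a point with a neighborhood isomorphic to a neighborhood of the apex in the following model: take an infinite Euclidean cone of total angle $\theta$, cut it along a ray from the apex, and reglue the right side of the ray to the left side by the homothety of ratio $\lambda$ fixing the apex. A closed geodesic is a locally straight simple loop in $X\setminus\Lambda$. It is called hyperbolic if the modulus of its linear holonomy (the linear part $a$ of the affine transition map obtained by continuing a chart along the loop) is different from $1$, and flat otherwise. A closed geodesic belongs to a cylinder, the maximal family of closed geodesics obtained by continuation; here a cylinder means the open set which is the union of this maximal family (boundary not included). A hyperbolic cylinder of angle $\beta>0$ is a cylinder formed by hyperbolic closed geodesics, isomorphic to the quotient of $\{(r,\varphi): r>0,\ 0<\varphi<\beta\}$, with affine structure given by $z=re^{i\varphi}$, by $(r,\varphi)\sim(\lambda r,\varphi)$ for some $\lambda>1$ (the closed geodesics are the curves $\varphi=$ const). *)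

theory Defs
  imports "HOL-Analysis.Analysis" "HOL-Complex_Analysis.Winding_Numbers"
begin

text \<open>A chart on a space \<open>X\<close> is a pair \<open>(U, c)\<close>; only the values of \<open>c\<close> on \<open>U\<close> matter.\<close>

type_synonym 'a chart = "'a set \<times> ('a \<Rightarrow> complex)"

definition is_chart :: "'a topology \<Rightarrow> 'a chart \<Rightarrow> bool" where
  "is_chart X = (\<lambda>(U, c). openin X U \<and> open (c ` U) \<and>
     homeomorphic_map (subtopology X U) (top_of_set (c ` U)) c)"

definition chart_domains :: "'a chart set \<Rightarrow> 'a set" where
  "chart_domains A = \<Union> (fst ` A)"


section \<open>Compact orientable topological surfaces\<close>

text \<open>An open embedding between open subsets of the plane preserves the orientation iff
  small positively oriented circles around a point are mapped to loops of winding number 1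
  around its image.\<close>

definition orientation_preserving_on :: "complex set \<Rightarrow> (complex \<Rightarrow> complex) \<Rightarrow> bool" where
  "orientation_preserving_on S f \<longleftrightarrow>
     (\<forall>z\<in>S. \<forall>r>0. cball z r \<subseteq> S \<longrightarrow> winding_number (f \<circ> circlepath z r) (f z) = 1)"

definition orientable_surface :: "'a topology \<Rightarrow> bool" where
  "orientable_surface X \<longleftrightarrow>
     Hausdorff_space X \<and> second_countable X \<and>
     (\<exists>B. (\<forall>C\<in>B. is_chart X C) \<and> chart_domains B = topspace X \<and>
          (\<forall>(U, c)\<in>B. \<forall>(V, d)\<in>B.
             orientation_preserving_on (c ` (U \<inter> V)) (d \<circ> inv_into U c)))"


section \<open>Affine structures\<close>

text \<open>As usual for geometric structures, a transition map is only required to be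
  affine near each point of the overlap, which may be disconnected.\<close>

definition affine_atlas :: "'a topology \<Rightarrow> 'a set \<Rightarrow> 'a chart set \<Rightarrow> bool" where
  "affine_atlas X S A \<longleftrightarrow>
     (\<forall>C\<in>A. is_chart X C) \<and> chart_domains A = S \<and>
     (\<forall>(U, c)\<in>A. \<forall>(V, d)\<in>A. \<forall>p\<in>U \<inter> V.
        \<exists>a b. a \<noteq> 0 \<and> (\<forall>\<^sub>F x in nhdsin X p. d x = a * c x + b))"

text \<open>Polar coordinates \<open>(r, \<phi>)\<close> with unrestricted angle: \<open>z = r e\<^sup>i\<^sup>\<phi>\<close> is the developing map of the
  affine structure on \<open>{(r, \<phi>). r > 0}\<close>. A map from an open part \<open>W\<close> of this half-plane to a surface
  is locally affine if it reads \<open>a z + b\<close> with \<open>a \<noteq> 0\<close> in the charts of the surface; such a map is in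
  particular a local homeomorphism.\<close>

definition polar :: "real \<times> real \<Rightarrow> complex" where
  "polar x = of_real (fst x) * cis (snd x)"

definition locally_affine_polar ::
    "'a topology \<Rightarrow> 'a chart set \<Rightarrow> (real \<times> real) set \<Rightarrow> (real \<times> real \<Rightarrow> 'a) \<Rightarrow> bool" where
  "locally_affine_polar X A W \<Phi> \<longleftrightarrow>
     \<Phi> ` W \<subseteq> chart_domains A \<and>
     (\<forall>x\<in>W. \<forall>(U, c)\<in>A. \<Phi> x \<in> U \<longrightarrow>
        (\<exists>a b. a \<noteq> 0 \<and> (\<forall>\<^sub>F y in nhds x. \<Phi> y \<in> U \<and> c (\<Phi> y) = a * polar y + b)))"


section \<open>Conical singularities\<close>

text \<open>Cutting the cone of angle \<open>\<theta>\<close> along a ray gives the sector \<open>0 \<le> \<phi> \<le> \<theta>\<close> with \<open>r = 0\<close> collapsed to the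
  apex, and the regluing identifies \<open>(r, 0)\<close> with \<open>(\<rho> r, \<theta>)\<close>. Unrolling the angle, the model is the
  quotient of \<open>{(r, \<phi>). r \<ge> 0}\<close> by the group generated by \<open>(r, \<phi>) \<mapsto> (\<rho> r, \<phi> + \<theta>)\<close>, with \<open>r = 0\<close>
  collapsed; this map is affine for the structure given by \<open>z = r e\<^sup>i\<^sup>\<phi>\<close>.\<close>

definition cone_equiv :: "real \<Rightarrow> real \<Rightarrow> real \<times> real \<Rightarrow> real \<times> real \<Rightarrow> bool" where
  "cone_equiv \<theta> \<rho> x y \<longleftrightarrow>
     (fst x = 0 \<and> fst y = 0) \<or>
     (\<exists>k::int. fst y = \<rho> powi k * fst x \<and> snd y = snd x + of_int k * \<theta>)"

text \<open>\<open>W\<close> is the preimage of a neighbourhood of the apex of the model, and \<open>\<Psi>\<close> is the projection to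
  the model followed by the isomorphism onto the neighbourhood \<open>U\<close> of \<open>p\<close>.\<close>

definition conical_singularity ::
    "'a topology \<Rightarrow> 'a chart set \<Rightarrow> 'a \<Rightarrow> real \<Rightarrow> real \<Rightarrow> bool" where
  "conical_singularity X A p \<theta> \<rho> \<longleftrightarrow>
     \<theta> > 0 \<and> \<rho> > 0 \<and>
     (\<exists>U W \<Psi>.
        openin X U \<and> p \<in> U \<and>
        openin (top_of_set ({0..} \<times> UNIV)) W \<and> {0} \<times> UNIV \<subseteq> W \<and>
        (\<forall>r \<phi>. (r, \<phi>) \<in> W \<longleftrightarrow> (\<rho> * r, \<phi> + \<theta>) \<in> W) \<and>
        (\<forall>\<phi>. \<Psi> (0, \<phi>) = p) \<and>
        (\<forall>x\<in>W. \<forall>y\<in>W. \<Psi> x = \<Psi> y \<longleftrightarrow> cone_equiv \<theta> \<rho> x y) \<and>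
        quotient_map (top_of_set W) (subtopology X U) \<Psi> \<and>
        locally_affine_polar X A (W \<inter> {0<..} \<times> UNIV) \<Psi>)"

definition branched_affine_surface ::
    "'a topology \<Rightarrow> 'a set \<Rightarrow> 'a chart set \<Rightarrow> bool" where
  "branched_affine_surface X \<Lambda> A \<longleftrightarrow>
     compact_space X \<and> orientable_surface X \<and>
     \<Lambda> \<subseteq> topspace X \<and> finite \<Lambda> \<and> \<Lambda> \<noteq> {} \<and>
     affine_atlas X (topspace X - \<Lambda>) A \<and>
     (\<forall>p\<in>\<Lambda>. \<exists>\<theta> \<rho>. conical_singularity X A p \<theta> \<rho>)"


section \<open>Closed geodesics\<close>

text \<open>Loops are parametrized as maps of period 1 on the real line, so that straightness is also
  imposed at the base point. The speed is not required to be constant: a hyperbolic closed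
  geodesic has no periodic affine parametrization.\<close>

definition closed_geodesic :: "'a topology \<Rightarrow> 'a chart set \<Rightarrow> (real \<Rightarrow> 'a) \<Rightarrow> bool" where
  "closed_geodesic X A \<gamma> \<longleftrightarrow>
     continuous_map euclideanreal X \<gamma> \<and> range \<gamma> \<subseteq> chart_domains A \<and>
     (\<forall>t. \<gamma> (t + 1) = \<gamma> t) \<and> inj_on \<gamma> {0..<1} \<and>
     (\<forall>t. \<forall>(U, c)\<in>A. \<gamma> t \<in> U \<longrightarrow>
        (\<exists>v. v \<noteq> 0 \<and> (\<forall>\<^sub>F s in nhds t. \<exists>x::real. c (\<gamma> s) = c (\<gamma> t) + of_real x * v)))"

definition affine_chart_at :: "'a topology \<Rightarrow> 'a chart set \<Rightarrow> 'a \<Rightarrow> ('a \<Rightarrow> complex) \<Rightarrow> bool" where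
  "affine_chart_at X A p g \<longleftrightarrow>
     (\<exists>(U, c)\<in>A. p \<in> U \<and> (\<exists>a b. a \<noteq> 0 \<and> (\<forall>\<^sub>F x in nhdsin X p. g x = a * c x + b)))"

text \<open>\<open>g t\<close> is the continuation along \<open>\<gamma>\<close> of the chart \<open>g 0\<close>, as a germ at \<open>\<gamma> t\<close>.\<close>

definition has_linear_holonomy ::
    "'a topology \<Rightarrow> 'a chart set \<Rightarrow> (real \<Rightarrow> 'a) \<Rightarrow> complex \<Rightarrow> bool" where
  "has_linear_holonomy X A \<gamma> a \<longleftrightarrow>
     (\<exists>g. (\<forall>t\<in>{0..1}. affine_chart_at X A (\<gamma> t) (g t)) \<and>
          (\<forall>t\<in>{0..1}. \<forall>\<^sub>F s in at t within {0..1}. \<forall>\<^sub>F x in nhdsin X (\<gamma> s). g s x = g t x) \<and>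
          (\<exists>b. \<forall>\<^sub>F x in nhdsin X (\<gamma> 0). g 1 x = a * g 0 x + b))"

definition hyperbolic_geodesic :: "'a topology \<Rightarrow> 'a chart set \<Rightarrow> (real \<Rightarrow> 'a) \<Rightarrow> bool" where
  "hyperbolic_geodesic X A \<gamma> \<longleftrightarrow>
     closed_geodesic X A \<gamma> \<and> (\<exists>a. has_linear_holonomy X A \<gamma> a \<and> cmod a \<noteq> 1)"


section \<open>Cylinders\<close>

text \<open>Continuation of a closed geodesic is a homotopy all of whose stages are closed geodesics.\<close>

definition geodesic_family ::
    "'a topology \<Rightarrow> 'a chart set \<Rightarrow> (real \<Rightarrow> 'a) \<Rightarrow> (real \<Rightarrow> 'a) set" where
  "geodesic_family X A \<gamma> =
     {\<gamma>'. homotopic_with (closed_geodesic X A) euclideanreal X \<gamma> \<gamma>'}"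

definition cylinder_of :: "'a topology \<Rightarrow> 'a chart set \<Rightarrow> (real \<Rightarrow> 'a) \<Rightarrow> 'a set" where
  "cylinder_of X A \<gamma> = (\<Union>\<gamma>'\<in>geodesic_family X A \<gamma>. range \<gamma>')"

text \<open>\<open>\<Phi>\<close> is the projection of the sector to its quotient followed by the isomorphism onto \<open>C\<close>. That the
  closed geodesics in \<open>C\<close> are the curves on which \<open>\<phi>\<close> is constant need not be required: a straight
  line invariant under a homothety of ratio different from 1 passes through the origin.\<close>

definition hyperbolic_cylinder ::
    "'a topology \<Rightarrow> 'a chart set \<Rightarrow> real \<Rightarrow> 'a set \<Rightarrow> bool" where
  "hyperbolic_cylinder X A \<beta> C \<longleftrightarrow>
     \<beta> > 0 \<and>
     (\<exists>\<gamma>. closed_geodesic X A \<gamma> \<and> C = cylinder_of X A \<gamma> \<and>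
          (\<forall>\<gamma>'\<in>geodesic_family X A \<gamma>. hyperbolic_geodesic X A \<gamma>')) \<and>
     (\<exists>l>1. \<exists>\<Phi>. locally_affine_polar X A ({0<..} \<times> {0<..<\<beta>}) \<Phi> \<and>
        \<Phi> ` ({0<..} \<times> {0<..<\<beta>}) = C \<and>
        (\<forall>x\<in>{0<..} \<times> {0<..<\<beta>}. \<forall>y\<in>{0<..} \<times> {0<..<\<beta>}.
           \<Phi> x = \<Phi> y \<longleftrightarrow> (\<exists>k::int. fst y = l powi k * fst x \<and> snd y = snd x)))"

end

theory Submission
  imports Defs
begin

text \<open>A hyperbolic cylinder is the image of a strip \<open>0 < Im \<zeta> < \<beta>\<close> developed by \<open>exp\<close>, and every closed geodesic
  contained in it is homotopic, through closed geodesics, to a fixed radial one or its reverse. Hence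
  two cylinders that contain a common closed geodesic coincide.

  If two cylinders of angle at least \<open>\<pi> / 2\<close> meet at a point, that point lies in a quadrant of each, and both
  quadrants can be developed in the same plane, where the two projections to the surface agree on the
  overlap. Neither apex can lie in the closure of the other quadrant unless the apexes coincide:
  dilations towards it would give a fibre accumulating at a point other than the apex. As the angles
  are right, the quadrants then share a direction. A ray in this direction stays in the overlap and
  accumulates, in either cylinder, on the closed geodesic of that direction, which is therefore common
  to both cylinders.\<close>


section \<open>Locally affine maps\<close>

text \<open>A cylinder has two descriptions: the union of a homotopy class of closed geodesics, and
  the image of a sector. The first decides whether two cylinders are equal, the second carries the
  geometry, so closed geodesics inside the sector must be brought to a normal form up to homotopy.
  In logarithmic coordinates the homothety is a translation, loops lift by means of a complex
  logarithm, and the angle is an imaginary part.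

  Two cylinders are compared on quadrants rather than on their whole sectors. A sector may wind
  around its apex many times, and two sectors may overlap in many components. A quadrant embeds in
  the plane and is convex, so the overlap of two developed quadrants is connected and a single
  affine transition is valid on all of it.

  The two homotheties have unrelated ratios and possibly different centres, so no single dilation
  pulls the common ray back to both geodesics. Its points are rescaled separately by powers of
  either ratio: one sequence converges, the other stays in a compact part of its quadrant, and the
  two limits have the same image because the surface is Hausdorff.\<close>

definition locally_affine ::
    "'a topology \<Rightarrow> 'a chart set \<Rightarrow> ('b::t2_space \<Rightarrow> complex) \<Rightarrow> 'b set \<Rightarrow> ('b \<Rightarrow> 'a) \<Rightarrow> bool" where
  "locally_affine X A dev W f \<longleftrightarrow>
     f ` W \<subseteq> chart_domains A \<and>
     (\<forall>x\<in>W. \<forall>(U, c)\<in>A. f x \<in> U \<longrightarrow>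
        (\<exists>a b. a \<noteq> 0 \<and> (\<forall>\<^sub>F y in nhds x. f y \<in> U \<and> c (f y) = a * dev y + b)))"

lemma locally_affine_polar_iff: "locally_affine_polar X A W f \<longleftrightarrow> locally_affine X A polar W f"
  unfolding locally_affine_polar_def locally_affine_def ..

lemma locally_affine_chart:
  assumes "locally_affine X A dev W f" "x \<in> W" "(U, c) \<in> A" "f x \<in> U"
  obtains a b where "a \<noteq> 0" "\<forall>\<^sub>F y in nhds x. f y \<in> U \<and> c (f y) = a * dev y + b"
  using assms unfolding locally_affine_def by fast

lemma locally_affine_domain:
  "locally_affine X A dev W f \<Longrightarrow> x \<in> W \<Longrightarrow> f x \<in> chart_domains A"
  unfolding locally_affine_def by blast

text \<open>Serves every change of coordinates below: from \<open>polar\<close> to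
  \<open>exp\<close> on a strip, from \<open>exp\<close> to the identity on a quadrant, and through
  an affine map of the plane. The constants \<open>k\<close> and \<open>m\<close> are absorbed by
  the coefficients in each chart.\<close>

lemma locally_affine_compose:
  assumes f: "locally_affine X A dev W f" and V: "open V" and h: "continuous_on V h"
    and hV: "h ` V \<subseteq> W" and k: "k \<noteq> 0" and eq: "\<And>y. y \<in> V \<Longrightarrow> dev (h y) = k * dev' y + m"
  shows "locally_affine X A dev' V (\<lambda>y. f (h y))"
  unfolding locally_affine_def
proof (intro conjI ballI, safe)
  show "f (h x) \<in> chart_domains A" if "x \<in> V" for x
    using f hV that unfolding locally_affine_def by blast
next
  fix x U c assume x: "x \<in> V" and Uc: "(U, c) \<in> A" and fx: "f (h x) \<in> U"
  then have "h x \<in> W" using hV by blast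
  with f Uc fx obtain a b where a: "a \<noteq> 0"
    and ev: "\<forall>\<^sub>F z in nhds (h x). f z \<in> U \<and> c (f z) = a * dev z + b"
    unfolding locally_affine_def by fast
  have "filterlim h (nhds (h x)) (nhds x)"
    using h V x unfolding tendsto_at_iff_tendsto_nhds[symmetric]
    by (metis continuous_on_eq_continuous_at isCont_def)
  then have "\<forall>\<^sub>F y in nhds x. f (h y) \<in> U \<and> c (f (h y)) = a * dev (h y) + b"
    using ev by (rule eventually_compose_filterlim[rotated])
  moreover have "\<forall>\<^sub>F y in nhds x. y \<in> V"
    using V x by (rule eventually_nhds_in_open)
  ultimately have "\<forall>\<^sub>F y in nhds x. f (h y) \<in> U \<and> c (f (h y)) = (a * k) * dev' y + (a * m + b)"
    by eventually_elim (simp add: eq algebra_simps)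
  then show "\<exists>a b. a \<noteq> 0 \<and> (\<forall>\<^sub>F y in nhds x. f (h y) \<in> U \<and> c (f (h y)) = a * dev' y + b)"
    using a k by (intro exI[of _ "a * k"] exI[of _ "a * m + b"]) simp
qed

locale affine_structure =
  fixes X :: "'a topology" and S :: "'a set" and A :: "'a chart set"
  assumes Hausdorff: "Hausdorff_space X" and atlas: "affine_atlas X S A"
begin

lemma chart_inj: "(U, c) \<in> A \<Longrightarrow> inj_on c U"
  and chart_open: "(U, c) \<in> A \<Longrightarrow> openin X U"
proof -
  assume "(U, c) \<in> A"
  then have 1: "openin X U" "homeomorphic_map (subtopology X U) (top_of_set (c ` U)) c"
    using atlas unfolding affine_atlas_def is_chart_def by fast+
  then show "inj_on c U" "openin X U"
    using homeomorphic_imp_injective_map[OF 1(2)] openin_subset[OF 1(1)]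
    by (auto simp: inf_absorb2)
qed

lemma chart_domains_subset: "chart_domains A \<subseteq> topspace X"
  using openin_subset[OF chart_open] unfolding chart_domains_def by fastforce

lemma chart_exists:
  assumes "x \<in> chart_domains A" obtains U c where "(U, c) \<in> A" "x \<in> U"
  using assms unfolding chart_domains_def by auto

lemma chart_preimage_open:
  assumes "(U, c) \<in> A" "open T"
  shows "openin X {x \<in> U. c x \<in> T}"
proof -
  have "openin X U" "homeomorphic_map (subtopology X U) (top_of_set (c ` U)) c"
    using assms atlas unfolding affine_atlas_def is_chart_def by fast+
  then have "continuous_map (subtopology X U) euclidean c"
    using homeomorphic_imp_continuous_map continuous_map_in_subtopology by blast
  then have "openin (subtopology X U) {x \<in> topspace (subtopology X U). c x \<in> T}"
    using assms(2) by (intro openin_continuous_map_preimage) (auto simp flip: open_openin)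
  moreover have "topspace (subtopology X U) = U"
    using openin_subset[OF \<open>openin X U\<close>] by (simp add: inf_absorb2)
  ultimately show ?thesis
    using openin_trans_full[OF _ \<open>openin X U\<close>] by (simp only:)
qed

lemma chart_image_openin:
  assumes "(U, c) \<in> A" "openin X V"
  shows "open (c ` (U \<inter> V))"
proof -
  have "openin X U" "open (c ` U)" "homeomorphic_map (subtopology X U) (top_of_set (c ` U)) c"
    using assms atlas unfolding affine_atlas_def is_chart_def by fast+
  then have "openin (top_of_set (c ` U)) (c ` (U \<inter> V))"
    using homeomorphic_imp_open_map[of "subtopology X U"] openin_subtopology_Int2[OF assms(2), of U]
    unfolding open_map_def by blast
  then show ?thesis
    using \<open>open (c ` U)\<close> openin_open_trans by blast
qed

text \<open>Continuity is not built into \<open>locally_affine\<close>; it comes from the charts.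
  The value \<open>c (f y)\<close> falls into the open image of \<open>U \<inter> V\<close> under
  \<open>c\<close>, and injectivity of \<open>c\<close> on \<open>U\<close> brings
  \<open>f y\<close> back into \<open>V\<close>.\<close>

lemma locally_affine_nhds:
  assumes f: "locally_affine X A dev W f" and w: "w \<in> W" and dev: "isCont dev w"
    and V: "openin X V" "f w \<in> V"
  shows "\<forall>\<^sub>F y in nhds w. f y \<in> V"
proof -
  have "f w \<in> chart_domains A" using f w unfolding locally_affine_def by blast
  then obtain U c where Uc: "(U, c) \<in> A" "f w \<in> U" by (rule chart_exists)
  then obtain a b where ev: "\<forall>\<^sub>F y in nhds w. f y \<in> U \<and> c (f y) = a * dev y + b"
    using locally_affine_chart[OF f w Uc] by blast
  have "isCont (\<lambda>y. a * dev y + b) w" using dev by (intro continuous_intros)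
  then have lim: "filterlim (\<lambda>y. a * dev y + b) (nhds (a * dev w + b)) (nhds w)"
    using tendsto_at_iff_tendsto_nhds[of "\<lambda>y. a * dev y + b" w] by (simp add: isCont_def)
  have "a * dev w + b \<in> c ` (U \<inter> V)"
    using eventually_nhds_x_imp_x[OF ev] V Uc by (metis IntI image_eqI)
  then have "\<forall>\<^sub>F y in nhds w. a * dev y + b \<in> c ` (U \<inter> V)"
    using chart_image_openin[OF Uc(1) V(1)] lim topological_tendstoD by blast
  with ev show ?thesis
    by eventually_elim (use chart_inj[OF Uc(1)] in \<open>auto dest: inj_onD\<close>)
qed

lemma locally_affine_continuous_map:
  assumes f: "locally_affine X A dev W f" and dev: "\<And>w. w \<in> W \<Longrightarrow> isCont dev w"
  shows "continuous_map (top_of_set W) X f"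
  unfolding continuous_map_def
proof (intro conjI allI impI)
  have "f ` W \<subseteq> topspace X"
    using f chart_domains_subset unfolding locally_affine_def by blast
  then show "f \<in> topspace (top_of_set W) \<rightarrow> topspace X" by auto
  fix V assume V: "openin X V"
  show "openin (top_of_set W) {x \<in> topspace (top_of_set W). f x \<in> V}"
  proof (subst openin_subopen, safe)
    fix x assume x: "x \<in> topspace (top_of_set W)" "f x \<in> V"
    with locally_affine_nhds[OF f _ dev V] have "\<forall>\<^sub>F y in nhds x. f y \<in> V" by auto
    then obtain T where "open T" "x \<in> T" "\<forall>y\<in>T. f y \<in> V" by (auto simp: eventually_nhds)
    with x show "\<exists>T. openin (top_of_set W) T \<and> x \<in> T \<and> T \<subseteq> {x \<in> topspace (top_of_set W). f x \<in> V}"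
      by (intro exI[of _ "W \<inter> T"]) auto
  qed
qed

lemma locally_affine_limitin:
  assumes f: "locally_affine X A dev W f" and w: "w \<in> W" and dev: "isCont dev w"
    and g: "(g \<longlongrightarrow> w) F"
  shows "limitin X (\<lambda>n. f (g n)) (f w) F"
proof -
  have "f w \<in> topspace X"
    using f w chart_domains_subset unfolding locally_affine_def by blast
  then show ?thesis
    unfolding limitin_def
    using eventually_compose_filterlim[OF locally_affine_nhds[OF f w dev] g] by blast
qed

end

section \<open>Closed geodesics and lifts to a strip\<close>

lemma closed_geodesic_shift:
  assumes "closed_geodesic X A \<gamma>" shows "\<gamma> (t + of_int k) = \<gamma> t"
proof -
  have per: "\<gamma> (t + 1) = \<gamma> t" for t using assms unfolding closed_geodesic_def by blast
  show ?thesis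
  proof (induction k rule: int_induct[where k = 0])
    case (step1 i) then show ?case using per[of "t + of_int i"] by (simp add: add.assoc)
  next
    case (step2 i) then show ?case using per[of "t + of_int (i - 1)"] by (simp add: algebra_simps)
  qed simp
qed

lemma closed_geodesic_eq_iff:
  assumes "closed_geodesic X A \<gamma>" shows "\<gamma> s = \<gamma> t \<longleftrightarrow> (\<exists>k::int. t = s + of_int k)"
proof
  assume eq: "\<gamma> s = \<gamma> t"
  have fr: "\<gamma> (frac x) = \<gamma> x" for x
    using closed_geodesic_shift[OF assms, of x "- \<lfloor>x\<rfloor>"] by (simp add: frac_def)
  have "inj_on \<gamma> {0..<1}" using assms unfolding closed_geodesic_def by blast
  then have "frac s = frac t"
    by (rule inj_onD) (use eq fr in \<open>auto simp: frac_ge_0 frac_lt_1\<close>)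
  then show "\<exists>k::int. t = s + of_int k"
    by (intro exI[of _ "\<lfloor>t\<rfloor> - \<lfloor>s\<rfloor>"]) (simp add: frac_def)
next
  assume "\<exists>k::int. t = s + of_int k"
  then show "\<gamma> s = \<gamma> t" using closed_geodesic_shift[OF assms] by metis
qed

lemma closed_geodesic_chart:
  assumes "closed_geodesic X A \<gamma>" "(U, c) \<in> A" "\<gamma> t \<in> U"
  obtains v where "v \<noteq> 0" "\<forall>\<^sub>F s in nhds t. \<exists>x::real. c (\<gamma> s) = c (\<gamma> t) + of_real x * v"
proof -
  have "\<forall>(U, c)\<in>A. \<gamma> t \<in> U \<longrightarrow>
    (\<exists>v. v \<noteq> 0 \<and> (\<forall>\<^sub>F s in nhds t. \<exists>x::real. c (\<gamma> s) = c (\<gamma> t) + of_real x * v))"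
    using assms(1) unfolding closed_geodesic_def by blast
  from bspec[OF this assms(2)] show thesis using assms(3) that by auto
qed

lemma closed_geodesic_reverse:
  assumes g: "closed_geodesic X A \<gamma>" shows "closed_geodesic X A (\<lambda>t. \<gamma> (- t))"
  unfolding closed_geodesic_def
proof (intro conjI)
  have "continuous_map euclideanreal euclideanreal (uminus :: real \<Rightarrow> real)"
    by (simp add: continuous_on_minus)
  moreover have "continuous_map euclideanreal X \<gamma>" using g unfolding closed_geodesic_def by blast
  ultimately show "continuous_map euclideanreal X (\<lambda>t. \<gamma> (- t))"
    by (metis (mono_tags, lifting) continuous_map_compose continuous_map_eq comp_apply)
  show "range (\<lambda>t. \<gamma> (- t)) \<subseteq> chart_domains A"
    using g unfolding closed_geodesic_def by blast
  show "\<forall>t. \<gamma> (- (t + 1)) = \<gamma> (- t)"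
    using closed_geodesic_shift[OF g, of "- t" "-1" for t] by (simp add: algebra_simps)
  show "inj_on (\<lambda>t. \<gamma> (- t)) {0..<1}"
  proof (rule inj_onI)
    fix s t :: real assume st: "s \<in> {0..<1}" "t \<in> {0..<1}" and "\<gamma> (- s) = \<gamma> (- t)"
    then obtain k :: int where "- t = - s + of_int k"
      using closed_geodesic_eq_iff[OF g] by blast
    with st have "- 1 < real_of_int k" "real_of_int k < 1" by auto
    then have "k = 0" by linarith
    then show "s = t" using \<open>- t = - s + of_int k\<close> by simp
  qed
  show "\<forall>t. \<forall>(U, c)\<in>A. \<gamma> (- t) \<in> U \<longrightarrow>
      (\<exists>v. v \<noteq> 0 \<and> (\<forall>\<^sub>F s in nhds t. \<exists>x::real. c (\<gamma> (- s)) = c (\<gamma> (- t)) + of_real x * v))"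
  proof (intro allI ballI, safe)
    fix t U c assume "(U, c) \<in> A" "\<gamma> (- t) \<in> U"
    then obtain v where v: "v \<noteq> 0"
      "\<forall>\<^sub>F s in nhds (- t). \<exists>x::real. c (\<gamma> s) = c (\<gamma> (- t)) + of_real x * v"
      by (rule closed_geodesic_chart[OF g])
    have "filterlim uminus (nhds (- t)) (nhds t)"
      using tendsto_at_iff_tendsto_nhds[of uminus t] by (simp add: tendsto_minus)
    from eventually_compose_filterlim[OF v(2) this] v(1)
    show "\<exists>v. v \<noteq> 0 \<and> (\<forall>\<^sub>F s in nhds t. \<exists>x::real. c (\<gamma> (- s)) = c (\<gamma> (- t)) + of_real x * v)"
      by blast
  qed
qed

context affine_structure
begin

lemma chart_path_tendsto:
  assumes Uc: "(U, c) \<in> A" "\<gamma> t \<in> U" and g: "continuous_map euclideanreal X \<gamma>"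
  shows "\<forall>\<^sub>F s in nhds t. \<gamma> s \<in> U" and "((\<lambda>s. c (\<gamma> s)) \<longlongrightarrow> c (\<gamma> t)) (nhds t)"
proof -
  have pre: "\<forall>\<^sub>F s in nhds t. \<gamma> s \<in> V" if "openin X V" "\<gamma> t \<in> V" for V
  proof -
    have "open {s. \<gamma> s \<in> V}"
      using openin_continuous_map_preimage[OF g that(1)] by simp
    then show ?thesis using that(2) eventually_nhds_in_open[of "{s. \<gamma> s \<in> V}" t] by simp
  qed
  show "\<forall>\<^sub>F s in nhds t. \<gamma> s \<in> U" using pre chart_open Uc by blast
  show "((\<lambda>s. c (\<gamma> s)) \<longlongrightarrow> c (\<gamma> t)) (nhds t)"
  proof (rule topological_tendstoI)
    fix T assume "open T" "c (\<gamma> t) \<in> T"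
    then have "\<forall>\<^sub>F s in nhds t. \<gamma> s \<in> {x \<in> U. c x \<in> T}"
      using pre chart_preimage_open Uc by blast
    then show "\<forall>\<^sub>F s in nhds t. c (\<gamma> s) \<in> T" by eventually_elim simp
  qed
qed

end

section \<open>Lifting loops to the logarithmic strip\<close>

definition strip :: "real \<Rightarrow> complex set" where
  "strip \<beta> = {\<zeta>. 0 < Im \<zeta> \<and> Im \<zeta> < \<beta>}"

lemma strip_iff: "\<zeta> \<in> strip \<beta> \<longleftrightarrow> 0 < Im \<zeta> \<and> Im \<zeta> < \<beta>"
  by (simp add: strip_def)

lemma open_strip: "open (strip \<beta>)"
  unfolding strip_def by (intro open_Collect_conj open_Collect_less continuous_intros)

text \<open>A hyperbolic cylinder in the coordinate \<open>\<zeta>\<close> = log z: the homothety of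
  ratio \<open>exp L\<close> has become translation by \<open>L\<close>, and the angle of a point is
  \<open>Im \<zeta>\<close>.\<close>

locale hyperbolic_strip = affine_structure +
  fixes \<beta> L :: real and F :: "complex \<Rightarrow> 'a"
  assumes \<beta>: "\<beta> > 0" and L: "L > 0"
    and F: "locally_affine X A exp (strip \<beta>) F"
    and F_eq_iff: "\<And>\<zeta> \<zeta>'. \<lbrakk>\<zeta> \<in> strip \<beta>; \<zeta>' \<in> strip \<beta>\<rbrakk> \<Longrightarrow>
      F \<zeta> = F \<zeta>' \<longleftrightarrow> (\<exists>k::int. \<zeta>' = \<zeta> + of_int k * of_real L)"
begin

lemma continuous_F: "continuous_map (top_of_set (strip \<beta>)) X F"
  using F by (rule locally_affine_continuous_map) (auto intro: continuous_intros)

lemma local_lift: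
  assumes g: "continuous_map euclideanreal X \<gamma>" and \<zeta>: "\<zeta> \<in> strip \<beta>" "F \<zeta> = \<gamma> t"
  obtains y where "(y \<longlongrightarrow> \<zeta>) (nhds t)" "\<forall>\<^sub>F s in nhds t. F (y s) = \<gamma> s"
proof -
  have "F \<zeta> \<in> chart_domains A" using locally_affine_domain[OF F \<zeta>(1)] .
  then obtain U c where Uc: "(U, c) \<in> A" "F \<zeta> \<in> U" by (rule chart_exists)
  then obtain a b where a: "a \<noteq> 0"
    and ev: "\<forall>\<^sub>F z in nhds \<zeta>. F z \<in> U \<and> c (F z) = a * exp z + b"
    using locally_affine_chart[OF F \<zeta>(1) Uc] by blast
  have c\<zeta>: "c (\<gamma> t) = a * exp \<zeta> + b"
    using eventually_nhds_x_imp_x[OF ev] \<zeta>(2) by simp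
  define w where "w s = (c (\<gamma> s) - b) / (a * exp \<zeta>)" for s
  define y where "y s = \<zeta> + Ln (w s)" for s
  have gU: "\<gamma> t \<in> U" using Uc \<zeta> by simp
  have "(w \<longlongrightarrow> (c (\<gamma> t) - b) / (a * exp \<zeta>)) (nhds t)"
    unfolding w_def using a by (intro tendsto_intros chart_path_tendsto(2)[OF Uc(1) gU g]) auto
  then have w: "(w \<longlongrightarrow> 1) (nhds t)" using a c\<zeta> by simp
  then have "((\<lambda>s. \<zeta> + Ln (w s)) \<longlongrightarrow> \<zeta> + Ln 1) (nhds t)"
    by (intro tendsto_intros) auto
  then have y: "(y \<longlongrightarrow> \<zeta>) (nhds t)" unfolding y_def by simp
  have "\<forall>\<^sub>F s in nhds t. w s \<noteq> 0" using w by (rule tendsto_imp_eventually_ne) simp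
  with chart_path_tendsto(1)[OF Uc(1) gU g] eventually_compose_filterlim[OF ev y]
  have "\<forall>\<^sub>F s in nhds t. F (y s) = \<gamma> s"
  proof eventually_elim
    case (elim s)
    then have "c (F (y s)) = c (\<gamma> s)"
      unfolding y_def exp_add using a by (simp add: w_def)
    then show ?case using elim chart_inj[OF Uc(1)] by (auto dest: inj_onD)
  qed
  with y show thesis by (rule that)
qed

text \<open>Preimages are chosen pointwise, without any continuity. As \<open>\<kappa> * L\<close>
  is 2 pi i, the function \<open>exp (\<kappa> * \<zeta> t)\<close> does not depend on the choice,
  and local lifts show that it is continuous. A continuous logarithm of it on the real line, divided
  by \<open>\<kappa>\<close>, differs from \<open>\<zeta>\<close> by integer multiples of
  \<open>L\<close>: it is the lift.\<close>

lemma lift: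
  assumes g: "continuous_map euclideanreal X \<gamma>" and ran: "range \<gamma> \<subseteq> F ` strip \<beta>"
  obtains u where "continuous_on UNIV u" "\<And>t. u t \<in> strip \<beta>" "\<And>t. F (u t) = \<gamma> t"
proof -
  have "\<forall>t. \<exists>\<zeta>. \<zeta> \<in> strip \<beta> \<and> F \<zeta> = \<gamma> t"
  proof
    fix t
    have "\<gamma> t \<in> F ` strip \<beta>" using ran by (rule range_subsetD)
    then show "\<exists>\<zeta>. \<zeta> \<in> strip \<beta> \<and> F \<zeta> = \<gamma> t" by (metis imageE)
  qed
  then obtain \<zeta> where \<zeta>: "\<And>t. \<zeta> t \<in> strip \<beta>" "\<And>t. F (\<zeta> t) = \<gamma> t" by metis
  define \<kappa> where "\<kappa> = 2 * of_real pi * \<i> / of_real L"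
  have \<kappa>: "\<kappa> \<noteq> 0" "\<kappa> * of_real L = 2 * of_real pi * \<i>" using L by (auto simp: \<kappa>_def)
  have E: "isCont (\<lambda>t. exp (\<kappa> * \<zeta> t)) t" for t
  proof -
    obtain y where y: "(y \<longlongrightarrow> \<zeta> t) (nhds t)" "\<forall>\<^sub>F s in nhds t. F (y s) = \<gamma> s"
      using local_lift[OF g \<zeta>(1) \<zeta>(2)] .
    have "\<forall>\<^sub>F s in nhds t. y s \<in> strip \<beta>"
      using topological_tendstoD[OF y(1) open_strip \<zeta>(1)] .
    with y(2) have "\<forall>\<^sub>F s in nhds t. exp (\<kappa> * y s) = exp (\<kappa> * \<zeta> s)"
    proof eventually_elim
      case (elim s)
      then obtain k :: int where k: "\<zeta> s = y s + of_int k * of_real L"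
        using F_eq_iff[of "y s" "\<zeta> s"] \<zeta>[of s] by metis
      have "\<kappa> * \<zeta> s = \<kappa> * y s + 2 * of_real pi * \<i> * of_int k"
        unfolding k using \<kappa>(2) by (simp add: algebra_simps)
      then show ?case
        unfolding exp_eq by (intro exI[of _ "- k"]) (simp add: algebra_simps)
    qed
    moreover have "((\<lambda>s. exp (\<kappa> * y s)) \<longlongrightarrow> exp (\<kappa> * \<zeta> t)) (nhds t)"
      by (intro tendsto_intros y)
    ultimately have "((\<lambda>s. exp (\<kappa> * \<zeta> s)) \<longlongrightarrow> exp (\<kappa> * \<zeta> t)) (nhds t)"
      by (rule Lim_transform_eventually[rotated])
    then show ?thesis using tendsto_at_iff_tendsto_nhds[of "\<lambda>t. exp (\<kappa> * \<zeta> t)" t] by (simp add: isCont_def)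
  qed
  have "continuous_on UNIV (\<lambda>t. exp (\<kappa> * \<zeta> t))"
    using E by (simp add: continuous_on_eq_continuous_at)
  then obtain v where v: "continuous_on UNIV v" "\<And>t. exp (\<kappa> * \<zeta> t) = exp (v t)"
    using continuous_logarithm_on_contractible[of UNIV "\<lambda>t. exp (\<kappa> * \<zeta> t)"]
      convex_imp_contractible[OF convex_UNIV] by auto
  have *: "\<exists>k::int. v t / \<kappa> = \<zeta> t + of_int k * of_real L" for t
  proof -
    obtain n :: int where "v t = \<kappa> * \<zeta> t + of_real (of_int (2 * n) * pi) * \<i>"
      using v(2)[of t, symmetric] unfolding exp_eq by blast
    then have "v t = \<kappa> * (\<zeta> t + of_int n * of_real L)"
      using \<kappa>(2) by (simp add: algebra_simps)
    then show ?thesis using \<kappa>(1) by auto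
  qed
  have "v t / \<kappa> \<in> strip \<beta> \<and> F (v t / \<kappa>) = \<gamma> t" for t
  proof -
    obtain k :: int where k: "v t / \<kappa> = \<zeta> t + of_int k * of_real L" using * by blast
    have "Im (v t / \<kappa>) = Im (\<zeta> t)" unfolding k by simp
    then have "v t / \<kappa> \<in> strip \<beta>" using \<zeta>(1)[of t] by (simp only: strip_iff)
    then show ?thesis using F_eq_iff[of "\<zeta> t" "v t / \<kappa>"] k \<zeta>[of t] by metis
  qed
  moreover have "continuous_on UNIV (\<lambda>t. v t / \<kappa>)" using v(1) \<kappa>(1) by (intro continuous_intros) auto
  ultimately show thesis using that[of "\<lambda>t. v t / \<kappa>"] by blast
qed

end

text \<open>The hypothesis says that \<open>q\<close> induces an injective continuous self-map of
  the circle of length 1. Such a map has degree 1 or -1, and the degree is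
  \<open>\<epsilon>\<close>.\<close>

lemma unit_step_reparametrization:
  fixes q :: "real \<Rightarrow> real"
  assumes q: "continuous_on UNIV q"
    and iff: "\<And>s t. (\<exists>k::int. q t = q s + of_int k) \<longleftrightarrow> (\<exists>k::int. t = s + of_int k)"
  obtains \<epsilon> where "\<epsilon> = 1 \<or> \<epsilon> = -1" "\<And>t. q (t + 1) = q t + \<epsilon>" "strict_mono (\<lambda>t. \<epsilon> * q t)"
proof -
  have qc: "continuous_on T q" for T using q continuous_on_subset by blast
  define d where "d t = q (t + 1) - q t" for t
  have d_int: "\<exists>k::int. d t = of_int k" for t
  proof -
    have "\<exists>k::int. q (t + 1) = q t + of_int k" unfolding iff by (rule exI[of _ 1]) simp
    then show ?thesis by (auto simp: d_def)
  qed
  have "d constant_on UNIV"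
  proof (rule continuous_discrete_range_constant)
    show "connected (UNIV :: real set)" by (rule connected_UNIV)
    show "continuous_on UNIV d" unfolding d_def
      by (intro continuous_intros continuous_on_compose2[OF q]) auto
    show "\<exists>e>0. \<forall>y. y \<in> UNIV \<and> d y \<noteq> d x \<longrightarrow> e \<le> norm (d y - d x)" for x
    proof (intro exI[of _ 1] conjI allI impI)
      fix y assume ne: "y \<in> UNIV \<and> d y \<noteq> d x"
      obtain j k :: int where "d y = of_int j" "d x = of_int k" using d_int by metis
      with ne show "1 \<le> norm (d y - d x)" by (auto simp flip: of_int_diff)
    qed simp
  qed
  then obtain r where "\<And>t. d t = r" unfolding constant_on_def by blast
  moreover from this obtain n :: int where "r = of_int n" using d_int by metis
  ultimately have n: "q (t + 1) = q t + of_int n" for t by (metis d_def diff_add_cancel add.commute)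
  have shift: "q (t + of_int k) = q t + of_int k * of_int n" for t and k :: int
  proof (induction k rule: int_induct[where k = 0])
    case (step1 i) then show ?case using n[of "t + of_int i"] by (simp add: algebra_simps)
  next
    case (step2 i) then show ?case using n[of "t + of_int (i - 1)"] by (simp add: algebra_simps)
  qed simp
  have eqD: "\<exists>k::int. t = s + of_int k" if "q s = q t" for s t
  proof -
    have "\<exists>k::int. q t = q s + of_int k" using that by (intro exI[of _ 0]) simp
    then show ?thesis by (rule iffD1[OF iff])
  qed
  \<comment> \<open>In degree 0 the function \<open>q\<close> would have period 1 and hence a global
    maximum, but it is injective on short intervals and so strictly monotone there.\<close>
  have "n \<noteq> 0"
  proof
    assume "n = 0"
    have "\<exists>t0\<in>{0..1}. \<forall>t\<in>{0..1}. q t \<le> q t0"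
      using continuous_attains_sup[OF compact_Icc _ qc, of 0 1] by auto
    then obtain t0 where t0: "\<And>t. t \<in> {0..1} \<Longrightarrow> q t \<le> q t0" by blast
    have max: "q t \<le> q t0" for t
    proof -
      have "q t = q (frac t)" using shift[of "frac t" "\<lfloor>t\<rfloor>"] \<open>n = 0\<close> by (simp add: frac_def)
      then show ?thesis using t0[of "frac t"] frac_lt_1[of t] by (simp add: frac_ge_0 less_imp_le)
    qed
    have "inj_on q {t0 - 1/4..t0 + 1/4}"
    proof (rule inj_onI)
      fix s t assume st: "s \<in> {t0 - 1/4..t0 + 1/4}" "t \<in> {t0 - 1/4..t0 + 1/4}" and "q s = q t"
      then obtain k :: int where k: "t = s + of_int k" using eqD by blast
      with st have "real_of_int k < 1" "real_of_int k > -1" by auto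
      then have "k = 0" by linarith
      with k show "s = t" by simp
    qed
    from continuous_inj_imp_mono[OF _ _ qc this, of t0] max[of "t0 - 1/4"] max[of "t0 + 1/4"]
    show False by auto
  qed
  have "inj q"
  proof (rule injI)
    fix s t assume "q s = q t"
    then obtain k :: int where k: "t = s + of_int k" using eqD by blast
    with shift[of s k] \<open>q s = q t\<close> \<open>n \<noteq> 0\<close> show "s = t" by simp
  qed
  then have mono: "strict_mono_on UNIV q \<or> strict_antimono_on UNIV q"
    using injective_eq_monotone_map[OF _ q] by (simp add: is_interval_univ)
  \<comment> \<open>Between 0 and \<open>sgn n\<close> the function rises by at least 1, so the
    value \<open>q 0 + 1\<close> is attained. By \<open>iff\<close> this happens at an integer
    \<open>k\<close>, and then \<open>k * n = 1\<close>.\<close>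
  have "n = 1 \<or> n = -1"
  proof -
    have conn: "connected (range q)" using q by (rule connected_continuous_image) simp
    have "q (of_int (sgn n)) = q 0 + of_int \<bar>n\<bar>"
      using shift[of 0 "sgn n"] by (simp add: abs_sgn mult.commute)
    moreover have "real_of_int \<bar>n\<bar> \<ge> 1" using \<open>n \<noteq> 0\<close> by linarith
    ultimately have "q 0 + 1 \<le> q (of_int (sgn n))" by linarith
    then have "q 0 + 1 \<in> range q"
      by (rule connectedD_interval[OF conn rangeI rangeI, of 0, rotated]) simp
    then obtain t where t: "q t = q 0 + 1" by (metis imageE)
    then obtain k :: int where "t = 0 + of_int k" using iff[of t 0] by (metis of_int_1)
    with t shift[of 0 k] have "real_of_int (k * n) = 1" by simp
    then have "k * n = 1" by linarith
    then show ?thesis by (auto simp: zmult_eq_1_iff)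
  qed
  moreover have "strict_mono (\<lambda>t. of_int n * q t)"
    using mono
  proof
    assume m: "strict_mono_on UNIV q"
    then have "q 0 < q (0 + 1)" by (rule strict_mono_onD) auto
    then have "n = 1" using n[of 0] calculation by auto
    with m show ?thesis by simp
  next
    assume m: "strict_antimono_on UNIV q"
    then have "q (0 + 1) < q 0" by (rule monotone_onD) auto
    then have "n = -1" using n[of 0] calculation by auto
    with m show ?thesis by (auto simp: strict_mono_def monotone_on_def)
  qed
  ultimately show thesis using that[of "of_int n"] n by auto
qed

context hyperbolic_strip
begin

text \<open>On a straight segment the angle is either constant or strictly monotone, so it cannot have a
  maximum along a closed geodesic unless it is constant.\<close>

lemma lift_Im_constant:
  assumes g: "closed_geodesic X A \<gamma>" and u: "continuous_on UNIV u"
    and us: "\<And>t. u t \<in> strip \<beta>" and Fu: "\<And>t. F (u t) = \<gamma> t"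
  obtains \<psi> where "0 < \<psi>" "\<psi> < \<beta>" "\<And>t. Im (u t) = \<psi>"
proof -
  have uc: "(u \<longlongrightarrow> u t) (nhds t)" for t
    using u tendsto_at_iff_tendsto_nhds[of u t]
    by (simp add: continuous_on_eq_continuous_at isCont_def)
  have Im_eq: "Im (u s) = Im (u t)" if "\<gamma> s = \<gamma> t" for s t
    using F_eq_iff[OF us us, of s t] Fu that by auto
  have "\<exists>t0\<in>{0..1}. \<forall>t\<in>{0..1}. Im (u t) \<le> Im (u t0)"
    using continuous_attains_sup[OF compact_Icc _ continuous_on_Im[OF continuous_on_subset[OF u]], of 0 1] by auto
  then obtain t0 where t0: "\<And>t. t \<in> {0..1} \<Longrightarrow> Im (u t) \<le> Im (u t0)" by blast
  define M where "M = Im (u t0)"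
  have max: "Im (u t) \<le> M" for t
  proof -
    have "\<gamma> t = \<gamma> (frac t)"
      using closed_geodesic_shift[OF g, of "frac t" "\<lfloor>t\<rfloor>"] by (simp add: frac_def)
    then have "Im (u t) = Im (u (frac t))" by (rule Im_eq)
    then show ?thesis using t0[of "frac t"] frac_lt_1[of t] by (simp add: frac_ge_0 less_imp_le M_def)
  qed
  have loc: "\<forall>\<^sub>F s in nhds t. Im (u s) = M" if tM: "Im (u t) = M" for t
  proof -
    have "F (u t) \<in> chart_domains A" using locally_affine_domain[OF F us] .
    then obtain U c where Uc: "(U, c) \<in> A" "F (u t) \<in> U" by (rule chart_exists)
    then obtain a b where a: "a \<noteq> 0"
      and ev: "\<forall>\<^sub>F z in nhds (u t). F z \<in> U \<and> c (F z) = a * exp z + b"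
      using locally_affine_chart[OF F us Uc] by blast
    have "\<gamma> t \<in> U" using Uc Fu by simp
    then obtain v where v: "\<forall>\<^sub>F s in nhds t. \<exists>x::real. c (\<gamma> s) = c (\<gamma> t) + of_real x * v"
      using closed_geodesic_chart[OF g Uc(1)] by metis
    \<comment> \<open>Dividing by \<open>exp (u t)\<close> turns the ray through this point into the
      positive real axis, and \<open>h\<close> is the height over that axis. It is linear along the
      segment, \<open>h s = x * Im \<kappa>\<close>, and \<open>Im \<kappa> = 0\<close> means that
      the segment is radial.\<close>
    define h where "h s = Im (exp (u s - u t))" for s
    define \<kappa> where "\<kappa> = v / (a * exp (u t))"
    have hsin: "h s = exp (Re (u s - u t)) * sin (Im (u s) - M)" for s
      by (simp add: h_def Im_exp tM)
    have "((\<lambda>s. Im (u s)) \<longlongrightarrow> Im (u t)) (nhds t)" by (intro tendsto_intros uc)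
    \<comment> \<open>Together with the maximality of \<open>M\<close> this confines
      \<open>Im (u s) - M\<close> to an interval where the sine is nonpositive and vanishes only at
      0.\<close>
    then have "\<forall>\<^sub>F s in nhds t. M - pi < Im (u s)"
      by (rule order_tendstoD) (simp add: tM)
    then have near: "\<forall>\<^sub>F s in nhds t. \<gamma> s \<in> U \<and> (\<exists>x::real. c (\<gamma> s) = c (\<gamma> t) + of_real x * v \<and>
        h s = x * Im \<kappa>) \<and> M - pi < Im (u s)"
      using eventually_compose_filterlim[OF ev uc] v
    proof eventually_elim
      case (elim s)
      then obtain x :: real where x: "c (\<gamma> s) = c (\<gamma> t) + of_real x * v" by blast
      have "a * exp (u s) = a * exp (u t) + of_real x * v"
        using elim x eventually_nhds_x_imp_x[OF ev] Fu by simp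
      then have "exp (u s) = exp (u t) + of_real x * v / a"
        using a by (simp add: field_simps)
      then have "exp (u s - u t) = 1 + of_real x * \<kappa>"
        using a by (simp add: exp_diff \<kappa>_def field_simps)
      then have "h s = x * Im \<kappa>" by (simp add: h_def)
      with x elim Fu show ?case by auto
    qed
    show ?thesis
    proof (cases "Im \<kappa> = 0")
      case True
      from near show ?thesis
      proof eventually_elim
        case (elim s)
        then have "sin (Im (u s) - M) = 0" using hsin[of s] True by auto
        moreover have "\<bar>Im (u s) - M\<bar> < pi" using elim max[of s] by linarith
        ultimately show ?case using sin_zero_pi_iff by fastforce
      qed
    next
      case False
      obtain e0 where e0: "e0 > 0" and
        e0P: "\<And>s. \<bar>s - t\<bar> < e0 \<Longrightarrow> \<gamma> s \<in> U \<and> (\<exists>x::real. c (\<gamma> s) = c (\<gamma> t) + of_real x * v \<and>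
          h s = x * Im \<kappa>) \<and> M - pi < Im (u s)"
        using near unfolding eventually_nhds_metric dist_real_def by blast
      \<comment> \<open>The bound 1/4 keeps two parameters less than a period apart, so that
        \<open>\<gamma>\<close> separates them.\<close>
      define e where "e = min (e0 / 2) (1 / 4)"
      have e: "e > 0" "e < e0" "e \<le> 1/4" using e0 by (auto simp: e_def)
      have "inj_on h {t - e..t + e}"
      proof (rule inj_onI)
        fix s s' assume ss: "s \<in> {t - e..t + e}" "s' \<in> {t - e..t + e}" and eq: "h s = h s'"
        have "\<bar>s - t\<bar> < e0" "\<bar>s' - t\<bar> < e0" using ss e by auto
        from this[THEN e0P] obtain x x' :: real where
          x: "c (\<gamma> s) = c (\<gamma> t) + of_real x * v" "h s = x * Im \<kappa>" "\<gamma> s \<in> U" and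
          x': "c (\<gamma> s') = c (\<gamma> t) + of_real x' * v" "h s' = x' * Im \<kappa>" "\<gamma> s' \<in> U" by blast
        have "x = x'" using eq x x' False by simp
        then have "\<gamma> s = \<gamma> s'" using x x' chart_inj[OF Uc(1)] by (metis inj_onD)
        then obtain k :: int where k: "s' = s + of_int k" using closed_geodesic_eq_iff[OF g] by blast
        with ss e have "real_of_int k < 1" "real_of_int k > -1" by auto
        then have "k = 0" by linarith
        with k show "s = s'" by simp
      qed
      moreover have "continuous_on {t - e..t + e} h"
        unfolding h_def by (intro continuous_intros continuous_on_subset[OF u]) auto
      ultimately have "(h (t - e) < h t \<and> h t < h (t + e)) \<or> (h (t + e) < h t \<and> h t < h (t - e))"
        using continuous_inj_imp_mono[of "t - e" t "t + e" h] e by auto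
      moreover have "h t = 0" by (simp add: h_def)
      moreover have "h s \<le> 0" if "\<bar>s - t\<bar> < e0" for s
      proof -
        have "0 \<le> M - Im (u s)" "M - Im (u s) \<le> pi" using max[of s] e0P[OF that] by auto
        then have "0 \<le> sin (M - Im (u s))" by (rule sin_ge_zero)
        moreover have "sin (Im (u s) - M) = - sin (M - Im (u s))"
          by (metis minus_diff_eq sin_minus)
        ultimately show ?thesis unfolding hsin by (simp add: mult_nonneg_nonpos)
      qed
      ultimately show ?thesis using e by (smt (verit))
    qed
  qed
  have "open {t. Im (u t) = M}"
  proof (subst open_subopen, rule ballI)
    fix t assume "t \<in> {t. Im (u t) = M}"
    then obtain T where "open T" "t \<in> T" "\<forall>s\<in>T. Im (u s) = M"
      using loc[of t] by (auto simp: eventually_nhds)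
    then show "\<exists>T. open T \<and> t \<in> T \<and> T \<subseteq> {t. Im (u t) = M}" by blast
  qed
  moreover have "closed {t. Im (u t) = M}"
    by (intro closed_Collect_eq continuous_intros u)
  ultimately have "{t. Im (u t) = M} = UNIV"
    using clopen[of "{t. Im (u t) = M}"] M_def by blast
  then have "Im (u t) = M" for t by blast
  then show thesis using us[of t0] by (intro that[of M]) (auto simp: strip_iff)
qed

end

section \<open>Closed geodesics of constant angle and their homotopies\<close>

lemma Complex_translate_iff:
  assumes "0 < (L::real)"
  shows "Complex (L * r') \<psi> = Complex (L * r) \<psi> + of_int k * of_real L \<longleftrightarrow> r' = r + of_int k"
proof -
  have "L * r' = L * r + of_int k * L \<longleftrightarrow> L * r' = L * (r + of_int k)" by (simp add: algebra_simps)
  then show ?thesis using assms by (simp add: complex_eq_iff)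
qed

context hyperbolic_strip
begin

text \<open>Straightness holds because \<open>exp\<close> maps the horizontal line of height
  \<open>\<psi>\<close> into the ray of direction \<open>cis \<psi>\<close>. A general
  parametrization \<open>p\<close> is allowed because the stages of the homotopy below interpolate
  between parametrizations; \<open>\<epsilon>\<close> records the sense of traversal.\<close>

lemma radial_closed_geodesic:
  assumes p: "continuous_on UNIV p" "\<And>t. p (t + 1) = p t + \<epsilon>" "strict_mono (\<lambda>t. \<epsilon> * p t)"
    and \<epsilon>: "\<epsilon> = 1 \<or> \<epsilon> = -1" and \<psi>: "0 < \<psi>" "\<psi> < \<beta>"
  shows "closed_geodesic X A (\<lambda>t. F (Complex (L * p t) \<psi>))"
proof -
  have st: "Complex r \<psi> \<in> strip \<beta>" for r using \<psi> by (simp add: strip_iff)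
  have cont: "continuous_on UNIV (\<lambda>t. Complex (L * p t) \<psi>)"
    unfolding Complex_eq by (intro continuous_intros p)
  have F_eq: "F (Complex (L * r) \<psi>) = F (Complex (L * r') \<psi>) \<longleftrightarrow> (\<exists>k::int. r' = r + of_int k)" for r r'
    unfolding F_eq_iff[OF st st] Complex_translate_iff[OF L] by simp
  show ?thesis
    unfolding closed_geodesic_def
  proof (intro conjI)
    have "continuous_map euclideanreal (top_of_set (strip \<beta>)) (\<lambda>t. Complex (L * p t) \<psi>)"
      using cont st by (auto simp: continuous_map_in_subtopology)
    from continuous_map_compose[OF this continuous_F]
    show "continuous_map euclideanreal X (\<lambda>t. F (Complex (L * p t) \<psi>))" by (simp add: o_def)
    show "range (\<lambda>t. F (Complex (L * p t) \<psi>)) \<subseteq> chart_domains A"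
      using locally_affine_domain[OF F st] by blast
    show "\<forall>t. F (Complex (L * p (t + 1)) \<psi>) = F (Complex (L * p t) \<psi>)"
    proof
      fix t
      have "\<exists>k::int. p t = p (t + 1) + of_int k"
        using \<epsilon> p(2)[of t] by (auto intro: exI[of _ 1] exI[of _ "-1"])
      then show "F (Complex (L * p (t + 1)) \<psi>) = F (Complex (L * p t) \<psi>)" unfolding F_eq .
    qed
    show "inj_on (\<lambda>t. F (Complex (L * p t) \<psi>)) {0..<1}"
    proof (rule linorder_inj_onI')
      fix s t :: real assume st: "s \<in> {0..<1}" "t \<in> {0..<1}" "s < t"
      show "F (Complex (L * p s) \<psi>) \<noteq> F (Complex (L * p t) \<psi>)"
      proof
        assume "F (Complex (L * p s) \<psi>) = F (Complex (L * p t) \<psi>)"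
        then obtain k :: int where k: "p t = p s + of_int k" unfolding F_eq by blast
        \<comment> \<open>Over one period \<open>\<epsilon> * p\<close> rises by the square of
          \<open>\<epsilon>\<close>, which is 1, and \<open>t\<close> is less than
          \<open>s + 1\<close>.\<close>
        have "\<epsilon> * p s < \<epsilon> * p t" "\<epsilon> * p t < \<epsilon> * p (s + 1)"
          using st by (auto intro!: strict_monoD[OF p(3)])
        with k \<epsilon> p(2)[of s] have "0 < \<bar>real_of_int k\<bar>" "\<bar>real_of_int k\<bar> < 1" by auto
        then show False by (simp flip: of_int_abs)
      qed
    qed
    show "\<forall>t. \<forall>(U, c)\<in>A. F (Complex (L * p t) \<psi>) \<in> U \<longrightarrow> (\<exists>v. v \<noteq> 0 \<and>
        (\<forall>\<^sub>F s in nhds t. \<exists>x::real. c (F (Complex (L * p s) \<psi>)) = c (F (Complex (L * p t) \<psi>)) + of_real x * v))"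
    proof (intro allI ballI, safe)
      fix t U c assume Uc: "(U, c) \<in> A" "F (Complex (L * p t) \<psi>) \<in> U"
      obtain a b where a: "a \<noteq> 0" and
        ev: "\<forall>\<^sub>F z in nhds (Complex (L * p t) \<psi>). F z \<in> U \<and> c (F z) = a * exp z + b"
        using locally_affine_chart[OF F st Uc] by blast
      have "((\<lambda>s. Complex (L * p s) \<psi>) \<longlongrightarrow> Complex (L * p t) \<psi>) (nhds t)"
        using cont tendsto_at_iff_tendsto_nhds[of "\<lambda>s. Complex (L * p s) \<psi>" t]
        by (simp add: continuous_on_eq_continuous_at isCont_def)
      from eventually_compose_filterlim[OF ev this]
      have "\<forall>\<^sub>F s in nhds t. \<exists>x::real. c (F (Complex (L * p s) \<psi>)) = c (F (Complex (L * p t) \<psi>)) + of_real x * (a * cis \<psi>)"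
      proof eventually_elim
        case (elim s)
        have "exp (Complex r \<psi>) = of_real (exp r) * cis \<psi>" for r by (simp add: exp_eq_polar)
        then show ?case
          using elim eventually_nhds_x_imp_x[OF ev]
          by (intro exI[of _ "exp (L * p s) - exp (L * p t)"]) (simp add: algebra_simps)
      qed
      then show "\<exists>v. v \<noteq> 0 \<and>
        (\<forall>\<^sub>F s in nhds t. \<exists>x::real. c (F (Complex (L * p s) \<psi>)) = c (F (Complex (L * p t) \<psi>)) + of_real x * v)"
        using a by (intro exI[of _ "a * cis \<psi>"]) simp
    qed
  qed
qed

text \<open>The lift has constant angle and a monotone real part with step
  \<open>\<epsilon>\<close>. Interpolating linearly, the angle to \<open>\<beta> / 2\<close> and the
  parametrization to \<open>\<epsilon> * t\<close>, stays among closed geodesics: the unit step and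
  the monotonicity both survive convex combinations.\<close>

lemma closed_geodesic_homotopic_radial:
  assumes g: "closed_geodesic X A \<gamma>" and ran: "range \<gamma> \<subseteq> F ` strip \<beta>"
  obtains \<epsilon> :: real where "\<epsilon> = 1 \<or> \<epsilon> = -1"
    "homotopic_with (closed_geodesic X A) euclideanreal X \<gamma> (\<lambda>t. F (Complex (L * (\<epsilon> * t)) (\<beta> / 2)))"
proof -
  have gc: "continuous_map euclideanreal X \<gamma>" using g unfolding closed_geodesic_def by blast
  obtain u where u: "continuous_on UNIV u" and us: "\<And>t. u t \<in> strip \<beta>" and Fu: "\<And>t. F (u t) = \<gamma> t"
    using lift[OF gc ran] by blast
  obtain \<psi> where \<psi>: "0 < \<psi>" "\<psi> < \<beta>" "\<And>t. Im (u t) = \<psi>"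
    using lift_Im_constant[OF g u us Fu] by blast
  define q where "q t = Re (u t) / L" for t
  have u_eq: "u t = Complex (L * q t) \<psi>" for t
    using L \<psi>(3)[of t] by (simp add: q_def complex_eq_iff)
  have qc: "continuous_on UNIV q" unfolding q_def using L by (intro continuous_intros u) auto
  have q_iff: "(\<exists>k::int. q t = q s + of_int k) \<longleftrightarrow> (\<exists>k::int. t = s + of_int k)" for s t
  proof -
    have "(\<exists>k::int. q t = q s + of_int k) \<longleftrightarrow> F (u s) = F (u t)"
      unfolding F_eq_iff[OF us us] unfolding u_eq Complex_translate_iff[OF L] by simp
    then show ?thesis using closed_geodesic_eq_iff[OF g] Fu by simp
  qed
  obtain \<epsilon> where \<epsilon>: "\<epsilon> = 1 \<or> \<epsilon> = -1" and q1: "\<And>t. q (t + 1) = q t + \<epsilon>"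
    and qm: "strict_mono (\<lambda>t. \<epsilon> * q t)"
    using unit_step_reparametrization[OF qc q_iff] by blast
  define P where "P s t = (1 - s) * q t + s * (\<epsilon> * t)" for s t
  define \<theta> where "\<theta> s = (1 - s) * \<psi> + s * (\<beta> / 2)" for s
  have \<theta>: "0 < \<theta> s \<and> \<theta> s < \<beta>" if "s \<in> {0..1}" for s
  proof -
    have "\<theta> s \<in> closed_segment \<psi> (\<beta> / 2)"
      using that unfolding \<theta>_def in_segment by auto
    moreover have "closed_segment \<psi> (\<beta> / 2) \<subseteq> {0<..<\<beta>}"
      using \<psi> \<beta> by (intro closed_segment_subset) (auto simp: convex_real_interval)
    ultimately show ?thesis by auto
  qed
  have "homotopic_with (closed_geodesic X A) euclideanreal X \<gamma> (\<lambda>t. F (Complex (L * (\<epsilon> * t)) (\<beta> / 2)))"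
    unfolding homotopic_with_def
  proof (intro exI[of _ "\<lambda>(s, t). F (Complex (L * P s t) (\<theta> s))"] conjI allI ballI)
    have "continuous_on ({0..1} \<times> UNIV) (\<lambda>x. Complex (L * P (fst x) (snd x)) (\<theta> (fst x)))"
      unfolding Complex_eq P_def \<theta>_def
      by (intro continuous_intros continuous_on_compose2[OF qc]) auto
    then have "continuous_map (top_of_set ({0..1} \<times> UNIV)) (top_of_set (strip \<beta>))
        (\<lambda>x. Complex (L * P (fst x) (snd x)) (\<theta> (fst x)))"
      using \<theta> by (auto simp: continuous_map_in_subtopology strip_iff)
    from continuous_map_compose[OF this continuous_F]
    show "continuous_map (prod_topology (top_of_set {0..1}) euclideanreal) X
        (\<lambda>(s, t). F (Complex (L * P s t) (\<theta> s)))"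
      using prod_topology_subtopology_eu[of "{0..1::real}" "UNIV :: real set"]
      by (simp add: o_def case_prod_beta')
    show "(case (0, t) of (s, t) \<Rightarrow> F (Complex (L * P s t) (\<theta> s))) = \<gamma> t" for t
      using Fu[of t] u_eq[of t] by (simp add: P_def \<theta>_def)
    show "(case (1, t) of (s, t) \<Rightarrow> F (Complex (L * P s t) (\<theta> s))) = F (Complex (L * (\<epsilon> * t)) (\<beta> / 2))" for t
      by (simp add: P_def \<theta>_def)
    fix s :: real assume s: "s \<in> {0..1}"
    have "closed_geodesic X A (\<lambda>t. F (Complex (L * P s t) (\<theta> s)))"
    proof (rule radial_closed_geodesic[OF _ _ _ \<epsilon>])
      show "continuous_on UNIV (P s)" unfolding P_def by (intro continuous_intros qc)
      show "P s (t + 1) = P s t + \<epsilon>" for t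
        unfolding P_def q1 by (simp add: algebra_simps)
      show "strict_mono (\<lambda>t. \<epsilon> * P s t)"
      proof (rule strict_monoI)
        fix t t' :: real assume "t < t'"
        then have 1: "\<epsilon> * q t < \<epsilon> * q t'" by (rule strict_monoD[OF qm])
        have "\<epsilon> * P s r = (1 - s) * (\<epsilon> * q r) + s * r" for r
          using \<epsilon> by (auto simp: P_def algebra_simps)
        moreover have "(1 - s) * (\<epsilon> * q t) + s * t < (1 - s) * (\<epsilon> * q t') + s * t'"
        proof (cases "s = 1")
          case False
          then have "(1 - s) * (\<epsilon> * q t) < (1 - s) * (\<epsilon> * q t')"
            using s by (intro mult_strict_left_mono 1) auto
          moreover have "s * t \<le> s * t'" using s \<open>t < t'\<close> by (intro mult_left_mono) auto
          ultimately show ?thesis by linarith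
        qed (use \<open>t < t'\<close> in simp)
        ultimately show "\<epsilon> * P s t < \<epsilon> * P s t'" by simp
      qed
    qed (use \<theta>[OF s] in auto)
    then show "closed_geodesic X A (\<lambda>x. case (s, x) of (s, t) \<Rightarrow> F (Complex (L * P s t) (\<theta> s)))"
      by simp
  qed
  with \<epsilon> show thesis using that by blast
qed

end

section \<open>The cylinder as determined by any closed geodesic in the strip\<close>

lemma cylinder_of_homotopic:
  assumes "homotopic_with (closed_geodesic X A) euclideanreal X \<gamma> \<gamma>'"
  shows "cylinder_of X A \<gamma> = cylinder_of X A \<gamma>'"
proof -
  have "\<delta> \<in> geodesic_family X A \<gamma> \<longleftrightarrow> \<delta> \<in> geodesic_family X A \<gamma>'" for \<delta>
  proof
    assume "\<delta> \<in> geodesic_family X A \<gamma>"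
    then show "\<delta> \<in> geodesic_family X A \<gamma>'" unfolding geodesic_family_def mem_Collect_eq
      by (rule homotopic_with_trans[OF homotopic_with_symD[OF assms]])
  next
    assume "\<delta> \<in> geodesic_family X A \<gamma>'"
    then show "\<delta> \<in> geodesic_family X A \<gamma>" unfolding geodesic_family_def mem_Collect_eq
      by (rule homotopic_with_trans[OF assms])
  qed
  then have "geodesic_family X A \<gamma> = geodesic_family X A \<gamma>'" by (rule set_eqI)
  then show ?thesis by (simp add: cylinder_of_def)
qed

text \<open>The family belongs to a parametrized loop, while a geodesic may traverse its ray in
  either sense. Reversing every stage of a homotopy matches the two families.\<close>

lemma cylinder_of_reverse_subset: "cylinder_of X A \<gamma> \<subseteq> cylinder_of X A (\<lambda>t. \<gamma> (- t))"
proof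
  fix x assume "x \<in> cylinder_of X A \<gamma>"
  then obtain \<gamma>' where h: "homotopic_with (closed_geodesic X A) euclideanreal X \<gamma> \<gamma>'" and x: "x \<in> range \<gamma>'"
    by (auto simp: cylinder_of_def geodesic_family_def)
  have "homotopic_with (closed_geodesic X A) euclideanreal X (\<gamma> \<circ> uminus) (\<gamma>' \<circ> uminus)"
  proof (rule homotopic_with_compose_continuous_map_right)
    show "homotopic_with (\<lambda>f. closed_geodesic X A (f \<circ> uminus)) euclideanreal X \<gamma> \<gamma>'"
      using h by (rule homotopic_with_mono) (simp add: o_def closed_geodesic_reverse)
    show "continuous_map euclideanreal euclideanreal (uminus :: real \<Rightarrow> real)"
      by (simp add: continuous_on_minus)
  qed
  then have "\<gamma>' \<circ> uminus \<in> geodesic_family X A (\<lambda>t. \<gamma> (- t))"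
    by (simp add: geodesic_family_def o_def)
  moreover have "x \<in> range (\<gamma>' \<circ> uminus)"
  proof -
    obtain t where "x = (\<gamma>' \<circ> uminus) (- t)" using x by auto
    then show ?thesis by (rule range_eqI)
  qed
  ultimately show "x \<in> cylinder_of X A (\<lambda>t. \<gamma> (- t))" unfolding cylinder_of_def by blast
qed

lemma cylinder_of_reverse: "cylinder_of X A (\<lambda>t. \<gamma> (- t)) = cylinder_of X A \<gamma>"
  using cylinder_of_reverse_subset[of X A \<gamma>] cylinder_of_reverse_subset[of X A "\<lambda>t. \<gamma> (- t)"] by simp

lemma (in hyperbolic_strip) cylinder_of_eq:
  assumes "closed_geodesic X A \<gamma>" "range \<gamma> \<subseteq> F ` strip \<beta>"
    and "closed_geodesic X A \<gamma>'" "range \<gamma>' \<subseteq> F ` strip \<beta>"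
  shows "cylinder_of X A \<gamma> = cylinder_of X A \<gamma>'"
proof -
  have *: "cylinder_of X A \<delta> = cylinder_of X A (\<lambda>t. F (Complex (L * t) (\<beta> / 2)))"
    if d: "closed_geodesic X A \<delta>" "range \<delta> \<subseteq> F ` strip \<beta>" for \<delta>
  proof -
    obtain \<epsilon> where \<epsilon>: "\<epsilon> = 1 \<or> \<epsilon> = -1" and
      "homotopic_with (closed_geodesic X A) euclideanreal X \<delta> (\<lambda>t. F (Complex (L * (\<epsilon> * t)) (\<beta> / 2)))"
      using closed_geodesic_homotopic_radial[OF d] .
    then have "cylinder_of X A \<delta> = cylinder_of X A (\<lambda>t. F (Complex (L * (\<epsilon> * t)) (\<beta> / 2)))"
      by (intro cylinder_of_homotopic)
    with \<epsilon> show ?thesis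
      using cylinder_of_reverse[of X A "\<lambda>t. F (Complex (L * t) (\<beta> / 2))"] by auto
  qed
  show ?thesis using *[OF assms(1,2)] *[OF assms(3,4)] by simp
qed

section \<open>Developing maps on a quadrant\<close>

definition quadrant :: "complex set" where
  "quadrant = {w. 0 < Re w \<and> 0 < Im w}"

lemma quadrant_iff: "w \<in> quadrant \<longleftrightarrow> 0 < Re w \<and> 0 < Im w"
  by (simp add: quadrant_def)

lemma open_quadrant: "open quadrant"
  unfolding quadrant_def by (intro open_Collect_conj open_Collect_less continuous_intros)

lemma convex_quadrant: "convex quadrant"
proof -
  have "quadrant = {w. Re w > 0} \<inter> {w. Im w > 0}" by (auto simp: quadrant_iff)
  then show ?thesis by (metis convex_Int convex_halfspace_Re_gt convex_halfspace_Im_gt)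
qed

lemma quadrant_cone:
  assumes "w \<in> quadrant" "r > 0" shows "of_real r * w \<in> quadrant"
  using assms by (simp add: quadrant_iff)

lemma quadrant_add: "w \<in> quadrant \<Longrightarrow> w' \<in> quadrant \<Longrightarrow> w + w' \<in> quadrant"
  by (simp add: quadrant_iff)

text \<open>The preimage of the quadrant under \<open>w \<mapsto> \<alpha> (w - p)\<close> is a quadrant with apex \<open>p\<close>. If it meets the standard one,
  either one apex lies in the closure of the other quadrant or the two have a common direction. This is
  where the angle \<open>\<pi> / 2\<close> matters.\<close>

lemma quadrant_trichotomy:
  assumes z: "z \<in> quadrant" and q: "\<alpha> * (z - p) \<in> quadrant"
  shows "(0 \<le> Re p \<and> 0 \<le> Im p) \<or> (0 \<le> Re (- \<alpha> * p) \<and> 0 \<le> Im (- \<alpha> * p)) \<or>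
    (\<exists>v\<in>quadrant. \<alpha> * v \<in> quadrant)"
proof -
  obtain a b where \<alpha>: "\<alpha> = Complex a b" by (cases \<alpha>)
  obtain x y where zxy: "z = Complex x y" by (cases z)
  obtain o1 o2 where p: "p = Complex o1 o2" by (cases p)
  define r1 where "r1 = a * (x - o1) - b * (y - o2)"
  define r2 where "r2 = a * (y - o2) + b * (x - o1)"
  have pos: "x > 0" "y > 0" "r1 > 0" "r2 > 0"
    using z q by (auto simp: \<alpha> zxy p quadrant_iff r1_def r2_def)
  define N where "N = a\<^sup>2 + b\<^sup>2"
  \<comment> \<open>With r = \<open>\<alpha> * (z - p)\<close> these are the coordinates of
    |\<alpha>|^2 p = |\<alpha>|^2 z - conj(\<alpha>) r. The identities \<open>m\<close> below are
    those of -\<alpha> p = r - \<alpha> z, the position of the first apex as seen from the second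
    quadrant.\<close>
  have o1: "N * o1 = N * x - (a * r1 + b * r2)" and o2: "N * o2 = N * y - (a * r2 - b * r1)"
    by (auto simp: N_def r1_def r2_def power2_eq_square algebra_simps)
  have N: "N > 0"
  proof -
    have "a \<noteq> 0 \<or> b \<noteq> 0" using pos by (auto simp: r1_def)
    then show ?thesis by (auto simp: N_def sum_power2_gt_zero_iff)
  qed
  have m: "- (a * o1 - b * o2) = r1 - a * x + b * y" "- (a * o2 + b * o1) = r2 - a * y - b * x"
    by (auto simp: r1_def r2_def algebra_simps)
  \<comment> \<open>The quadrants are turned against each other by the argument of
    \<open>\<alpha>\<close>, and share a direction iff it is acute, that is \<open>a > 0\<close>. In
    the first two cases \<open>e\<close> is small enough for a direction close to a coordinate axis
    to work.\<close>
  consider "a > 0" "b \<ge> 0" | "a > 0" "b < 0" | "a \<le> 0" "b \<ge> 0" | "a \<le> 0" "b < 0" by linarith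
  then show ?thesis
  proof cases
    case 1
    define e where "e = a / (2 * (b + 1))"
    have e: "e > 0" "b * e < a" using 1 by (auto simp: e_def field_simps intro: add_nonneg_pos)
    then have "Complex 1 e \<in> quadrant" "\<alpha> * Complex 1 e \<in> quadrant"
      using 1 by (auto simp: quadrant_iff \<alpha> intro: add_pos_nonneg)
    then show ?thesis by blast
  next
    case 2
    define e where "e = a / (2 * (1 - b))"
    have e: "e > 0" "- b * e < a" using 2 by (auto simp: e_def field_simps intro: add_nonneg_pos)
    then have "Complex e 1 \<in> quadrant" "\<alpha> * Complex e 1 \<in> quadrant"
      using 2 by (auto simp: quadrant_iff \<alpha> add.commute intro: add_pos_nonneg mult_pos_pos) (smt (verit) mult_pos_pos)+
    then show ?thesis by blast
  next
    case 3
    have 31: "a * x \<le> 0" "a * y \<le> 0" "a * r1 \<le> 0" "a * r2 \<le> 0" "b * x \<ge> 0" "b * y \<ge> 0" "b * r1 \<ge> 0"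
      using 3 pos by (auto simp: mult_nonpos_nonneg)
    \<comment> \<open>Only the imaginary part of -\<alpha> p can fail to be nonnegative. If it does,
      the resulting upper bound on \<open>r2\<close> forces \<open>p\<close> into the closed
      quadrant. The last case is the mirror image, with \<open>r1\<close>.\<close>
    show ?thesis
    proof (cases "r2 - a * y - b * x \<ge> 0")
      case True
      then have "0 \<le> Re (- \<alpha> * p) \<and> 0 \<le> Im (- \<alpha> * p)" using 31 pos m by (simp add: \<alpha> p)
      then show ?thesis by blast
    next
      case False
      then have "b * r2 \<le> b * (a * y + b * x)" using 3 by (intro mult_left_mono) auto
      moreover have "b * (a * y) \<le> 0" using 3 31 by (simp add: mult_nonneg_nonpos)
      moreover have "b\<^sup>2 * x \<le> N * x" using pos by (intro mult_right_mono) (auto simp: N_def)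
      ultimately have "0 \<le> N * o1" using 31 unfolding o1 by (simp add: algebra_simps power2_eq_square)
      moreover have "0 \<le> N * o2" using 31 N pos unfolding o2 by (smt (verit) mult_pos_pos)
      ultimately have "0 \<le> Re p \<and> 0 \<le> Im p" using N by (simp add: p zero_le_mult_iff)
      then show ?thesis by blast
    qed
  next
    case 4
    have 41: "a * x \<le> 0" "a * y \<le> 0" "a * r1 \<le> 0" "a * r2 \<le> 0" "b * x \<le> 0" "b * y \<le> 0" "b * r2 \<le> 0"
      using 4 pos by (auto simp: mult_nonpos_nonneg)
    show ?thesis
    proof (cases "r1 - a * x + b * y \<ge> 0")
      case True
      then have "0 \<le> Re (- \<alpha> * p) \<and> 0 \<le> Im (- \<alpha> * p)" using 41 pos m by (simp add: \<alpha> p)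
      then show ?thesis by blast
    next
      case False
      then have "(- b) * r1 \<le> (- b) * (a * x - b * y)" using 4 by (intro mult_left_mono) auto
      moreover have "(- b) * (a * x) \<le> 0" using 4 41 by (simp add: mult_nonpos_nonpos)
      moreover have "b\<^sup>2 * y \<le> N * y" using pos by (intro mult_right_mono) (auto simp: N_def)
      ultimately have "0 \<le> N * o2" using 41 unfolding o2 by (simp add: algebra_simps power2_eq_square)
      moreover have "0 \<le> N * o1" using 41 N pos unfolding o1 by (smt (verit) mult_pos_pos)
      ultimately have "0 \<le> Re p \<and> 0 \<le> Im p" using N by (simp add: p zero_le_mult_iff)
      then show ?thesis by blast
    qed
  qed
qed

section \<open>Comparison of two developed quadrants\<close>

context affine_structure
begin

text \<open>An identity principle. The set \<open>E\<close> is defined by germs, since affine maps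
  may agree at an isolated point, and is open. Its complement in \<open>\<Omega>\<close> is open as
  well: different values are separated by the Hausdorff property, and at a common value both maps
  are compared in one chart.\<close>

lemma locally_affine_identity:
  fixes f g :: "complex \<Rightarrow> 'a"
  assumes f: "locally_affine X A (\<lambda>w. w) \<Omega> f" and g: "locally_affine X A (\<lambda>w. w) \<Omega> g"
    and \<Omega>: "open \<Omega>" "connected \<Omega>" and w0: "w0 \<in> \<Omega>" "\<forall>\<^sub>F w in nhds w0. f w = g w"
    and w: "w \<in> \<Omega>"
  shows "f w = g w"
proof -
  define E where "E = {w. \<forall>\<^sub>F y in nhds w. f y = g y}"
  have "open E"
  proof (subst open_subopen, rule ballI)
    fix x assume "x \<in> E"
    then obtain T where T: "open T" "x \<in> T" "\<forall>y\<in>T. f y = g y" by (auto simp: E_def eventually_nhds)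
    then have "T \<subseteq> E" by (auto simp: E_def eventually_nhds)
    with T show "\<exists>T. open T \<and> x \<in> T \<and> T \<subseteq> E" by blast
  qed
  moreover have "open (\<Omega> - E)"
  proof (subst open_subopen, rule ballI)
    fix x assume x: "x \<in> \<Omega> - E"
    then have x\<Omega>: "x \<in> \<Omega>" and xE: "x \<notin> E" by auto
    have dom: "f x \<in> chart_domains A" "g x \<in> chart_domains A"
      using locally_affine_domain[OF f x\<Omega>] locally_affine_domain[OF g x\<Omega>] by auto
    have "\<forall>\<^sub>F y in nhds x. y \<notin> E"
    proof (cases "f x = g x")
      case False
      then obtain V V' where V: "openin X V" "openin X V'" "f x \<in> V" "g x \<in> V'" "disjnt V V'"
        using Hausdorff dom chart_domains_subset unfolding Hausdorff_space_def by (meson subsetD)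
      have "\<forall>\<^sub>F y in nhds x. f y \<in> V" "\<forall>\<^sub>F y in nhds x. g y \<in> V'"
        using locally_affine_nhds[OF f x\<Omega> _ V(1,3)] locally_affine_nhds[OF g x\<Omega> _ V(2,4)] by auto
      then show ?thesis
      proof eventually_elim
        case (elim y)
        then have "f y \<noteq> g y" using V(5) by (auto simp: disjnt_def)
        then show "y \<notin> E" using eventually_nhds_x_imp_x by (auto simp: E_def)
      qed
    next
      case True
      obtain U c where Uc: "(U, c) \<in> A" "f x \<in> U" using chart_exists[OF dom(1)] .
      obtain a b where ab: "\<forall>\<^sub>F y in nhds x. f y \<in> U \<and> c (f y) = a * y + b"
        using locally_affine_chart[OF f x\<Omega> Uc] by blast
      obtain a' b' where ab': "\<forall>\<^sub>F y in nhds x. g y \<in> U \<and> c (g y) = a' * y + b'"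
        using locally_affine_chart[OF g x\<Omega> Uc(1)] True Uc(2) by metis
      \<comment> \<open>Near \<open>x\<close>, equality of \<open>f\<close> and \<open>g\<close> is
        a single affine equation. If some \<open>y\<close> in this neighbourhood had equal germs,
        the coefficients would vanish and the germs at \<open>x\<close> would agree too.\<close>
      have "\<forall>\<^sub>F y in nhds x. (f y = g y) = ((a - a') * y + (b - b') = 0)"
        using ab ab'
      proof eventually_elim
        case (elim y)
        then have "f y = g y \<longleftrightarrow> c (f y) = c (g y)"
          using inj_on_eq_iff[OF chart_inj[OF Uc(1)]] by blast
        moreover have "(a - a') * y + (b - b') = (a * y + b) - (a' * y + b')"
          by (simp add: algebra_simps)
        ultimately show ?case using elim by (metis right_minus_eq)
      qed
      then obtain T where T: "open T" "x \<in> T" and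
        Teq: "\<And>y. y \<in> T \<Longrightarrow> (f y = g y) = ((a - a') * y + (b - b') = 0)"
        by (auto simp: eventually_nhds)
      have "y \<notin> E" if yT: "y \<in> T" for y
      proof
        assume "y \<in> E"
        then obtain T' where T': "open T'" "y \<in> T'" "\<And>w. w \<in> T' \<Longrightarrow> f w = g w"
          by (auto simp: E_def eventually_nhds)
        then obtain e where e: "e > 0" "ball y e \<subseteq> T \<inter> T'"
          using T(1) yT openE[of "T \<inter> T'" y] by (metis IntI open_Int)
        \<comment> \<open>A second root of the equation, distinct from \<open>y\<close>.\<close>
        define w1 where "w1 = y + of_real (e / 2)"
        have "w1 \<in> ball y e" using e by (simp add: w1_def dist_norm)
        then have "(a - a') * w1 + (b - b') = 0" "(a - a') * y + (b - b') = 0"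
          using e Teq T' yT by blast+
        moreover have "(a - a') * (w1 - y) = ((a - a') * w1 + (b - b')) - ((a - a') * y + (b - b'))"
          by (simp add: algebra_simps)
        ultimately have "(a - a') * (w1 - y) = 0" by simp
        then have "a = a'" using e by (simp add: w1_def)
        then have "b = b'" using Teq[OF yT] T'(2,3) by simp
        then have "x \<in> E" using \<open>a = a'\<close> T Teq by (auto simp: E_def eventually_nhds)
        with xE show False ..
      qed
      then show ?thesis using T by (auto simp: eventually_nhds)
    qed
    then obtain T where "open T" "x \<in> T" "\<forall>y\<in>T. y \<notin> E" by (auto simp: eventually_nhds)
    then show "\<exists>T. open T \<and> x \<in> T \<and> T \<subseteq> \<Omega> - E"
      using \<Omega>(1) x\<Omega> by (intro exI[of _ "T \<inter> \<Omega>"]) auto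
  qed
  ultimately have "E \<inter> \<Omega> = {} \<or> (\<Omega> - E) \<inter> \<Omega> = {}"
    using \<Omega>(2) by (intro connectedD) auto
  moreover have "w0 \<in> E \<inter> \<Omega>" using w0 by (simp add: E_def)
  ultimately have "w \<in> E" using w by blast
  then show ?thesis unfolding E_def using eventually_nhds_x_imp_x by blast
qed

text \<open>However large the angle of the cylinder, a right-angled subsector develops injectively,
  so \<open>f\<close> lives on part of the plane itself, with the identity as developing
  map.\<close>

definition dilation_quadrant :: "real \<Rightarrow> (complex \<Rightarrow> 'a) \<Rightarrow> bool" where
  "dilation_quadrant l f \<longleftrightarrow> l > 1 \<and> locally_affine X A (\<lambda>w. w) quadrant f \<and>
     (\<forall>w\<in>quadrant. \<forall>w'\<in>quadrant. f w = f w' \<longleftrightarrow> (\<exists>k::int. w' = of_real (l powi k) * w))"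

lemma dilation_quadrant_scale:
  assumes "dilation_quadrant l f" "w \<in> quadrant"
  shows "f (of_real (l powi k) * w) = f w" "of_real (l powi k) * w \<in> quadrant"
proof -
  have "l > 0" using assms unfolding dilation_quadrant_def by simp
  then have "l powi k > 0" by (simp add: zero_less_power_int)
  then show 1: "of_real (l powi k) * w \<in> quadrant" using quadrant_cone assms(2) by blast
  show "f (of_real (l powi k) * w) = f w"
    using assms 1 unfolding dilation_quadrant_def by metis
qed

text \<open>In a chart around the common image point both maps are affine, which matches them near
  \<open>z\<close> by an affine map. The set where both sides are defined is convex, hence
  connected, and the identity principle extends the match to all of it.\<close>

lemma dilation_quadrant_transition:
  assumes f: "dilation_quadrant l f" and g: "dilation_quadrant m g"
    and z: "z \<in> quadrant" "z' \<in> quadrant" "f z = g z'"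
  obtains \<alpha> p where "\<alpha> \<noteq> 0" "\<alpha> * (z - p) = z'"
    "\<And>w. w \<in> quadrant \<Longrightarrow> \<alpha> * (w - p) \<in> quadrant \<Longrightarrow> f w = g (\<alpha> * (w - p))"
proof -
  have fa: "locally_affine X A (\<lambda>w. w) quadrant f" and ga: "locally_affine X A (\<lambda>w. w) quadrant g"
    using f g unfolding dilation_quadrant_def by auto
  have "f z \<in> chart_domains A" using locally_affine_domain[OF fa z(1)] .
  then obtain U c where Uc: "(U, c) \<in> A" "f z \<in> U" by (rule chart_exists)
  obtain a b where a: "a \<noteq> 0" and ab: "\<forall>\<^sub>F y in nhds z. f y \<in> U \<and> c (f y) = a * y + b"
    using locally_affine_chart[OF fa z(1) Uc] by blast
  obtain a' b' where a': "a' \<noteq> 0" and ab': "\<forall>\<^sub>F y in nhds z'. g y \<in> U \<and> c (g y) = a' * y + b'"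
    using locally_affine_chart[OF ga z(2) Uc(1)] Uc(2) z(3) by metis
  define \<alpha> where "\<alpha> = a / a'"
  \<comment> \<open>The affine map is normalised by the point \<open>p\<close> that it sends to 0,
    the apex of the second quadrant.\<close>
  define p where "p = z - z' / \<alpha>"
  define T where "T w = \<alpha> * (w - p)" for w
  have \<alpha>: "\<alpha> \<noteq> 0" using a a' by (simp add: \<alpha>_def)
  have Tz: "T z = z'" using \<alpha> by (simp add: T_def p_def)
  define \<Omega> where "\<Omega> = quadrant \<inter> T -` quadrant"
  have Tc: "continuous_on UNIV T" unfolding T_def by (intro continuous_intros)
  have \<Omega>: "open \<Omega>" unfolding \<Omega>_def using open_vimage[OF open_quadrant Tc] open_quadrant by (rule open_Int[rotated])
  have "convex \<Omega>"
  proof (rule convexI)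
    fix x y and u v :: real assume xy: "x \<in> \<Omega>" "y \<in> \<Omega>" and uv: "0 \<le> u" "0 \<le> v" "u + v = 1"
    have "T (u *\<^sub>R x + v *\<^sub>R y) = \<alpha> * (u *\<^sub>R x + v *\<^sub>R y - (u + v) *\<^sub>R p)"
      unfolding uv(3) by (simp add: T_def)
    also have "\<dots> = u *\<^sub>R T x + v *\<^sub>R T y"
      by (simp add: T_def scaleR_conv_of_real algebra_simps)
    finally show "u *\<^sub>R x + v *\<^sub>R y \<in> \<Omega>"
      using xy uv convexD[OF convex_quadrant] unfolding \<Omega>_def by simp
  qed
  have f\<Omega>: "locally_affine X A (\<lambda>w. w) \<Omega> f"
    using fa unfolding locally_affine_def \<Omega>_def by blast
  have g\<Omega>: "locally_affine X A (\<lambda>w. w) \<Omega> (\<lambda>w. g (T w))"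
    by (rule locally_affine_compose[OF ga \<Omega> _ _ \<alpha>, where m = "- \<alpha> * p"])
      (auto simp: \<Omega>_def T_def algebra_simps intro!: continuous_intros)
  have z\<Omega>: "z \<in> \<Omega>" using z Tz by (simp add: \<Omega>_def)
  have "(T \<longlongrightarrow> z') (nhds z)"
    using Tc unfolding Tz[symmetric] tendsto_at_iff_tendsto_nhds[symmetric]
    by (simp add: continuous_on_eq_continuous_at isCont_def)
  from eventually_compose_filterlim[OF ab' this] ab
  have "\<forall>\<^sub>F y in nhds z. f y = g (T y)"
  proof eventually_elim
    case (elim y)
    have "a * z + b = a' * z' + b'"
      using eventually_nhds_x_imp_x[OF ab] eventually_nhds_x_imp_x[OF ab'] z(3) by simp
    then have b': "b' = a * z + b - a' * z'" by (simp add: algebra_simps)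
    have "a' * T y = a * y - a * z + a' * z'"
      using a a' by (simp add: T_def p_def \<alpha>_def field_simps)
    then have "a' * T y + b' = a * y + b" unfolding b' by simp
    then have "c (f y) = c (g (T y))" using elim by simp
    then show ?case using elim inj_on_eq_iff[OF chart_inj[OF Uc(1)]] by blast
  qed
  then have "f w = g (T w)" if "w \<in> \<Omega>" for w
    using locally_affine_identity[OF f\<Omega> g\<Omega> \<Omega> convex_connected[OF \<open>convex \<Omega>\<close>] z\<Omega> _ that] by blast
  with \<alpha> Tz show thesis using that[of \<alpha> p] unfolding \<Omega>_def T_def by blast
qed

text \<open>Contracting by \<open>m\<close> towards the second apex \<open>p\<close> produces points with the same image accumulating at
  \<open>p\<close>, while the fibres of \<open>f\<close> accumulate only at \<open>0\<close>.\<close>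

lemma dilation_quadrant_apex:
  assumes f: "dilation_quadrant l f" and g: "dilation_quadrant m g"
    and z: "z \<in> quadrant" "\<alpha> * (z - p) \<in> quadrant"
    and fg: "\<And>w. w \<in> quadrant \<Longrightarrow> \<alpha> * (w - p) \<in> quadrant \<Longrightarrow> f w = g (\<alpha> * (w - p))"
    and p: "0 \<le> Re p" "0 \<le> Im p"
  shows "p = 0"
proof (rule ccontr)
  assume "p \<noteq> 0"
  have l: "l > 1" and m: "m > 1" using f g unfolding dilation_quadrant_def by auto
  define \<tau> where "\<tau> k = inverse m ^ k" for k :: nat
  have \<tau>: "0 < \<tau> k" "\<tau> k \<le> 1" for k using m by (auto simp: \<tau>_def power_le_one inverse_le_1_iff)
  \<comment> \<open>The contracted point stays in the quadrant because \<open>p\<close> lies in its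
    closure. It has the same image as \<open>z\<close> because \<open>g\<close> is invariant under
    powers of \<open>m\<close>, so it lies in the \<open>l\<close>-orbit of
    \<open>z\<close>.\<close>
  have "\<exists>j::int. p + of_real (\<tau> k) * (z - p) = of_real (l powi j) * z" for k
  proof -
    define w where "w = p + of_real (\<tau> k) * (z - p)"
    have "Re w = (1 - \<tau> k) * Re p + \<tau> k * Re z" "Im w = (1 - \<tau> k) * Im p + \<tau> k * Im z"
      by (auto simp: w_def algebra_simps)
    then have wQ: "w \<in> quadrant"
      using \<tau>[of k] p z(1) by (simp add: quadrant_iff add_nonneg_pos)
    have \<alpha>w: "\<alpha> * (w - p) = of_real (m powi (- int k)) * (\<alpha> * (z - p))"
      by (simp add: w_def \<tau>_def power_int_minus power_inverse)
    have "f w = g (\<alpha> * (w - p))"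
      using fg[OF wQ] dilation_quadrant_scale(2)[OF g z(2)] \<alpha>w by metis
    also have "\<dots> = f z" unfolding \<alpha>w dilation_quadrant_scale(1)[OF g z(2)] fg[OF z] ..
    finally show ?thesis
      using f wQ z(1) unfolding dilation_quadrant_def w_def by metis
  qed
  then obtain j :: "nat \<Rightarrow> int" where j: "\<And>k. p + of_real (\<tau> k) * (z - p) = of_real (l powi j k) * z"
    by metis
  \<comment> \<open>Taking \<open>k = 1\<close> shows that \<open>p\<close> is a real multiple of
    \<open>z\<close>, with factor \<open>\<mu>\<close>. Everything is thereby reduced to real
    factors of \<open>z\<close>.\<close>
  define \<mu> where "\<mu> = (l powi j 1 - \<tau> 1) / (1 - \<tau> 1)"
  have \<tau>1: "\<tau> 1 < 1" using m by (simp add: \<tau>_def inverse_less_1_iff)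
  have "of_real (1 - \<tau> 1) * p = of_real (l powi j 1 - \<tau> 1) * z"
    using j[of 1] by (simp add: algebra_simps)
  then have p\<mu>: "p = of_real \<mu> * z" using \<tau>1 by (simp add: \<mu>_def field_simps)
  have "z \<noteq> 0" using z(1) by (auto simp: quadrant_iff)
  have "\<mu> \<noteq> 1" using z(2) p\<mu> by (auto simp: quadrant_iff)
  have "\<mu> \<ge> 0" using p z(1) by (simp add: p\<mu> quadrant_iff zero_le_mult_iff)
  with \<open>p \<noteq> 0\<close> p\<mu> have "\<mu> > 0" by auto
  have eq: "\<mu> + \<tau> k * (1 - \<mu>) = l powi j k" for k
  proof -
    have "of_real (\<mu> + \<tau> k * (1 - \<mu>)) * z = of_real (l powi j k) * z"
      using j[of k] unfolding p\<mu> by (simp add: algebra_simps)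
    then show ?thesis using \<open>z \<noteq> 0\<close> by (metis mult_right_cancel of_real_eq_iff)
  qed
  have "\<tau> \<longlonglongrightarrow> 0" unfolding \<tau>_def using m by (intro LIMSEQ_realpow_zero) (auto simp: inverse_less_1_iff)
  then have "(\<lambda>k. \<mu> + \<tau> k * (1 - \<mu>)) \<longlonglongrightarrow> \<mu> + 0 * (1 - \<mu>)" by (intro tendsto_intros)
  then have "(\<lambda>k. ln (l powi j k)) \<longlonglongrightarrow> ln \<mu>"
    unfolding eq using \<open>\<mu> > 0\<close> by (intro tendsto_ln) auto
  then have lim: "(\<lambda>k. of_int (j k) * ln l) \<longlonglongrightarrow> ln \<mu>"
    using l by (simp add: ln_powr flip: powr_real_of_int')
  \<comment> \<open>Convergence to a positive limit makes the exponents \<open>j k\<close>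
    eventually constant, whereas \<open>\<tau>\<close> is strictly decreasing and
    \<open>\<mu>\<close> is not 1.\<close>
  have "(\<lambda>k. of_int (j (Suc k)) * ln l - of_int (j k) * ln l) \<longlonglongrightarrow> ln \<mu> - ln \<mu>"
    by (intro tendsto_diff lim LIMSEQ_Suc)
  then have "(\<lambda>k. (of_int (j (Suc k)) * ln l - of_int (j k) * ln l) / ln l) \<longlonglongrightarrow> (ln \<mu> - ln \<mu>) / ln l"
    using l by (intro tendsto_divide tendsto_const) auto
  then have "(\<lambda>k. real_of_int (j (Suc k) - j k)) \<longlonglongrightarrow> 0"
    using l by (simp add: diff_divide_distrib)
  from tendstoD[OF this zero_less_one]
  have "\<forall>\<^sub>F k in sequentially. \<bar>real_of_int (j (Suc k) - j k)\<bar> < 1" by (simp add: dist_real_def)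
  then obtain k where "\<bar>real_of_int (j (Suc k) - j k)\<bar> < 1"
    by (auto simp: eventually_sequentially)
  then have "j (Suc k) = j k" by linarith
  then have "\<tau> (Suc k) * (1 - \<mu>) = \<tau> k * (1 - \<mu>)" 
    using eq[of k] eq[of "Suc k"] unfolding \<open>j (Suc k) = j k\<close> by linarith
  then have "\<tau> (Suc k) = \<tau> k" using \<open>\<mu> \<noteq> 1\<close> by simp
  then show False using m \<tau>[of k] by (simp add: \<tau>_def)
qed

text \<open>The first two alternatives of the trichotomy force \<open>p = 0\<close>, by the apex
  lemma as it stands or with the two quadrants exchanged; in the exchanged picture the transition is
  \<open>inverse \<alpha>\<close> and the apex is \<open>- \<alpha> * p\<close>. Once
  \<open>p = 0\<close>, the point \<open>z\<close> is itself a common direction.\<close>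

lemma dilation_quadrant_common_direction:
  assumes f: "dilation_quadrant l f" and g: "dilation_quadrant m g" and \<alpha>: "\<alpha> \<noteq> 0"
    and z: "z \<in> quadrant" "\<alpha> * (z - p) \<in> quadrant"
    and fg: "\<And>w. w \<in> quadrant \<Longrightarrow> \<alpha> * (w - p) \<in> quadrant \<Longrightarrow> f w = g (\<alpha> * (w - p))"
  obtains v where "v \<in> quadrant" "\<alpha> * v \<in> quadrant"
proof -
  have "p = 0" if "0 \<le> Re (- \<alpha> * p)" "0 \<le> Im (- \<alpha> * p)"
  proof -
    define z' where "z' = \<alpha> * (z - p)"
    have inv: "inverse \<alpha> * (w - (- \<alpha> * p)) = inverse \<alpha> * w + p" for w
      using \<alpha> by (simp add: algebra_simps)
    have "- \<alpha> * p = 0"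
    proof (rule dilation_quadrant_apex[OF g f _ _ _ that])
      show "z' \<in> quadrant" using z by (simp add: z'_def)
      show "inverse \<alpha> * (z' - (- \<alpha> * p)) \<in> quadrant"
        unfolding inv using z \<alpha> by (simp add: z'_def flip: mult.assoc)
      show "g w = f (inverse \<alpha> * (w - (- \<alpha> * p)))"
        if "w \<in> quadrant" "inverse \<alpha> * (w - (- \<alpha> * p)) \<in> quadrant" for w
        using fg[OF that(2)] that(1) \<alpha> unfolding inv by (simp flip: mult.assoc)
    qed
    then show ?thesis using \<alpha> by simp
  qed
  moreover have "p = 0" if "0 \<le> Re p" "0 \<le> Im p"
    using dilation_quadrant_apex[OF f g z fg that] .
  ultimately have "p = 0 \<or> (\<exists>v\<in>quadrant. \<alpha> * v \<in> quadrant)"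
    using quadrant_trichotomy[OF z] by blast
  with z that show thesis by auto
qed

text \<open>The two maps agree along the ray \<open>z + t v\<close>, which accumulates on the closed geodesic of direction
  \<open>v\<close> of either quadrant.\<close>

lemma dilation_quadrant_limit:
  assumes f: "dilation_quadrant l f" and g: "dilation_quadrant m g"
    and z: "z \<in> quadrant" "\<alpha> * (z - p) \<in> quadrant"
    and fg: "\<And>w. w \<in> quadrant \<Longrightarrow> \<alpha> * (w - p) \<in> quadrant \<Longrightarrow> f w = g (\<alpha> * (w - p))"
    and v: "v \<in> quadrant" "\<alpha> * v \<in> quadrant" and s: "s > 0"
  shows "g (of_real s * (\<alpha> * v)) \<in> f ` quadrant"
proof -
  have l: "l > 1" and m: "m > 1" using f g unfolding dilation_quadrant_def by auto
  have fa: "locally_affine X A (\<lambda>w. w) quadrant f" and ga: "locally_affine X A (\<lambda>w. w) quadrant g"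
    using f g unfolding dilation_quadrant_def by auto
  \<comment> \<open>Parameters along the ray at which rescaling by \<open>m powi (- int k)\<close>
    in the second quadrant gives \<open>s\<close> times \<open>\<alpha> * v\<close>, up to an error
    that tends to 0.\<close>
  define T where "T k = m ^ k * s" for k :: nat
  have T: "T k > 0" for k using m s by (simp add: T_def)
  \<comment> \<open>The power of \<open>l\<close> that brings \<open>T k\<close> into the
    fundamental interval from 1 to \<open>l\<close>. The powers of \<open>m\<close> and
    \<open>l\<close> being unrelated, the rescaled factors \<open>\<rho>\<close> need not converge,
    hence the subsequence \<open>r\<close>.\<close>
  define n where "n k = \<lfloor>log l (T k)\<rfloor>" for k
  define \<rho> where "\<rho> k = T k * l powi (- n k)" for k
  have \<rho>: "\<rho> k \<in> {1..l}" for k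
  proof -
    have "\<rho> k = l powr (log l (T k) - of_int (n k))"
      using T[of k] l by (simp add: \<rho>_def powr_diff powr_real_of_int' power_int_minus field_simps)
    moreover have "0 \<le> log l (T k) - of_int (n k)" "log l (T k) - of_int (n k) \<le> 1"
      unfolding n_def by linarith+
    ultimately show ?thesis using l powr_mono[of _ 1 l] by (auto simp: ge_one_powr_ge_zero)
  qed
  define x where "x k = z + of_real (T k) * v" for k
  define b where "b k = of_real (l powi (- n k)) * x k" for k
  define a where "a k = of_real (m powi (- int k)) * (\<alpha> * (x k - p))" for k
  have xQ: "x k \<in> quadrant" for k
    unfolding x_def using T[of k] by (intro quadrant_add quadrant_cone z v)
  have \<alpha>x: "\<alpha> * (x k - p) = \<alpha> * (z - p) + of_real (T k) * (\<alpha> * v)" for k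
    by (simp add: x_def algebra_simps)
  have \<alpha>xQ: "\<alpha> * (x k - p) \<in> quadrant" for k
    unfolding \<alpha>x using T[of k] by (intro quadrant_add quadrant_cone z v)
  have ab: "f (b k) = g (a k)" for k
    unfolding b_def a_def dilation_quadrant_scale(1)[OF f xQ] dilation_quadrant_scale(1)[OF g \<alpha>xQ]
    by (rule fg[OF xQ \<alpha>xQ])
  have im: "(\<lambda>k. inverse m ^ k) \<longlonglongrightarrow> 0"
    using m by (intro LIMSEQ_realpow_zero) (auto simp: inverse_less_1_iff)
  have a_eq: "a k = of_real (inverse m ^ k) * (\<alpha> * (z - p)) + of_real s * (\<alpha> * v)" for k
    using m by (simp add: a_def \<alpha>x T_def power_int_minus power_inverse field_simps)
  have "a \<longlonglongrightarrow> of_real 0 * (\<alpha> * (z - p)) + of_real s * (\<alpha> * v)"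
    unfolding a_eq by (intro tendsto_intros im)
  then have a_lim: "a \<longlonglongrightarrow> of_real s * (\<alpha> * v)" by simp
  obtain \<rho>' r where \<rho>': "\<rho>' \<in> {1..l}" and r: "strict_mono r" "(\<rho> \<circ> r) \<longlonglongrightarrow> \<rho>'"
    using compact_imp_seq_compact[OF compact_Icc[of 1 l]] \<rho> unfolding seq_compact_def by meson
  have b_eq: "b k = of_real (\<rho> k * inverse m ^ k / s) * z + of_real (\<rho> k) * v" for k
  proof -
    have "l powi (- n k) = \<rho> k * inverse m ^ k / s"
      using m s by (simp add: \<rho>_def T_def power_inverse field_simps)
    then show ?thesis by (simp add: b_def x_def \<rho>_def algebra_simps)
  qed
  have "(\<lambda>k. of_real (\<rho> (r k) * inverse m ^ (r k) / s) * z + of_real (\<rho> (r k)) * v)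
      \<longlonglongrightarrow> of_real (\<rho>' * 0 / s) * z + of_real \<rho>' * v"
    using r s LIMSEQ_subseq_LIMSEQ[OF im r(1)] by (intro tendsto_intros) (auto simp: o_def)
  then have b_lim: "(\<lambda>k. b (r k)) \<longlonglongrightarrow> of_real \<rho>' * v" unfolding b_eq by simp
  have \<rho>'v: "of_real \<rho>' * v \<in> quadrant" using \<rho>' by (intro quadrant_cone v) auto
  have "limitin X (\<lambda>k. f (b (r k))) (f (of_real \<rho>' * v)) sequentially"
    by (rule locally_affine_limitin[OF fa \<rho>'v _ b_lim]) simp
  moreover have "limitin X (\<lambda>k. g (a (r k))) (g (of_real s * (\<alpha> * v))) sequentially"
    using LIMSEQ_subseq_LIMSEQ[OF a_lim r(1)]
    by (intro locally_affine_limitin[OF ga quadrant_cone[OF v(2) s]]) (auto simp: o_def)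
  ultimately have "f (of_real \<rho>' * v) = g (of_real s * (\<alpha> * v))"
    unfolding ab using Hausdorff by (intro limitin_Hausdorff_unique) auto
  then show ?thesis using \<rho>'v by (metis imageI)
qed

end

section \<open>Passage from a cylinder to a quadrant\<close>

lemma Im_Ln_quadrant:
  assumes "w \<in> quadrant" shows "0 < Im (Ln w)" "Im (Ln w) < pi / 2"
proof -
  have w: "w \<noteq> 0" "0 < Re w" "0 < Im w" using assms by (auto simp: quadrant_iff)
  then show "0 < Im (Ln w)" using Im_Ln_pos_lt_imp[of w] by simp
  show "Im (Ln w) < pi / 2" using Re_Ln_pos_lt[of w] w by simp
qed

text \<open>A right-angled subsector around the given point fits into the sector; rotated by its
  lower angle it becomes the standard quadrant, and its rays become the closed geodesics of constant
  angle.\<close>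

lemma (in hyperbolic_strip) quadrant_chart:
  assumes \<beta>2: "pi / 2 \<le> \<beta>" and \<zeta>: "\<zeta> \<in> strip \<beta>"
  obtains f z where "dilation_quadrant (exp L) f" "f ` quadrant \<subseteq> F ` strip \<beta>"
    "z \<in> quadrant" "f z = F \<zeta>"
    "\<And>v. v \<in> quadrant \<Longrightarrow>
      \<exists>\<gamma>. closed_geodesic X A \<gamma> \<and> (\<forall>t. \<exists>r>0. \<gamma> t = f (of_real r * v))"
proof -
  have \<zeta>': "0 < Im \<zeta>" "Im \<zeta> < \<beta>" using \<zeta> by (auto simp: strip_iff)
  \<comment> \<open>The lower angle of the subsector: placed at the bottom or at the top of the
    strip when \<open>\<zeta>\<close> is near an edge, and centred at \<open>Im \<zeta>\<close>
    otherwise.\<close>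
  obtain s where s: "0 \<le> s" "s + pi / 2 \<le> \<beta>" "s < Im \<zeta>" "Im \<zeta> < s + pi / 2"
  proof -
    consider "Im \<zeta> < pi / 2" | "Im \<zeta> > \<beta> - pi / 2" | "pi / 2 \<le> Im \<zeta>" "Im \<zeta> \<le> \<beta> - pi / 2"
      by linarith
    then show thesis
    proof cases
      case 1 then show thesis using \<zeta>' \<beta>2 by (intro that[of 0]) auto
    next
      case 2 then show thesis using \<zeta>' \<beta>2 by (intro that[of "\<beta> - pi / 2"]) auto
    next
      case 3 then show thesis using \<zeta>' \<beta>2 pi_gt_zero by (intro that[of "Im \<zeta> - pi / 4"]) linarith+
    qed
  qed
  \<comment> \<open>Inverts \<open>\<zeta> \<mapsto> exp (\<zeta> - \<i> * s)\<close>; on the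
    quadrant the principal logarithm stays off its branch cut and has imaginary part between 0 and
    pi/2.\<close>
  define h where "h w = Ln w + \<i> * of_real s" for w
  define f where "f w = F (h w)" for w
  have h: "h w \<in> strip \<beta>" if "w \<in> quadrant" for w
    using Im_Ln_quadrant[OF that] s by (simp add: h_def strip_iff)
  have nz: "w \<noteq> 0" if "w \<in> quadrant" for w using that by (auto simp: quadrant_iff)
  have "locally_affine X A (\<lambda>w. w) quadrant f"
    unfolding f_def
  proof (rule locally_affine_compose[OF F open_quadrant, where k = "exp (\<i> * of_real s)" and m = 0])
    show "continuous_on quadrant h" unfolding h_def
      by (intro continuous_intros) (auto simp: quadrant_iff complex_nonpos_Reals_iff)
  qed (use h nz in \<open>auto simp: h_def exp_add\<close>)
  moreover have "f w = f w' \<longleftrightarrow> (\<exists>k::int. w' = of_real (exp L powi k) * w)"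
    if w: "w \<in> quadrant" "w' \<in> quadrant" for w w'
  proof -
    have "h w' = h w + of_int k * of_real L \<longleftrightarrow> w' = of_real (exp L powi k) * w" for k :: int
    proof -
      have e: "exp L powi k = exp (of_int k * L)" by (rule exp_power_int)
      have "h w' = h w + of_int k * of_real L \<longleftrightarrow> Ln w' = of_real (of_int k * L) + Ln w"
        by (auto simp: h_def)
      also have "of_real (of_int k * L) + Ln w = Ln (of_real (exp (of_int k * L)) * w)"
        using Ln_times_of_real[of "exp (of_int k * L)" w] nz[OF w(1)] by (simp add: Ln_of_real)
      also have "Ln w' = Ln (of_real (exp (of_int k * L)) * w) \<longleftrightarrow> w' = of_real (exp (of_int k * L)) * w"
        using nz w by (intro Ln_eq_iff) auto
      finally show ?thesis unfolding e .
    qed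
    then show ?thesis unfolding f_def F_eq_iff[OF h[OF w(1)] h[OF w(2)]] by simp
  qed
  ultimately have 1: "dilation_quadrant (exp L) f"
    unfolding dilation_quadrant_def using L by simp
  have 2: "f ` quadrant \<subseteq> F ` strip \<beta>" using h by (auto simp: f_def)
  define z where "z = exp (\<zeta> - \<i> * of_real s)"
  have "0 < cos (Im \<zeta> - s)" "0 < sin (Im \<zeta> - s)"
    using s pi_gt_zero by (auto intro!: cos_gt_zero_pi sin_gt_zero)
  then have 3: "z \<in> quadrant" by (simp add: z_def quadrant_iff Re_exp Im_exp)
  have 4: "f z = F \<zeta>"
    using s pi_gt_zero by (simp add: f_def h_def z_def Ln_exp)
  have "\<exists>\<gamma>. closed_geodesic X A \<gamma> \<and> (\<forall>t. \<exists>r>0. \<gamma> t = f (of_real r * v))"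
    if v: "v \<in> quadrant" for v
  proof -
    define \<psi> where "\<psi> = Im (Ln v) + s"
    have "closed_geodesic X A (\<lambda>t. F (Complex (L * t) \<psi>))"
      using Im_Ln_quadrant[OF v] s
      by (intro radial_closed_geodesic[of "\<lambda>t. t" 1]) (auto simp: \<psi>_def strict_mono_def)
    moreover have "\<exists>r>0. F (Complex (L * t) \<psi>) = f (of_real r * v)" for t
    proof -
      define r where "r = exp (L * t - Re (Ln v))"
      have "h (of_real r * v) = of_real (L * t - Re (Ln v)) + Ln v + \<i> * of_real s"
        using Ln_times_of_real[of r v] nz[OF v] by (simp add: h_def r_def Ln_of_real)
      also have "\<dots> = Complex (L * t) \<psi>" by (simp add: complex_eq_iff \<psi>_def)
      finally show "\<exists>r>0. F (Complex (L * t) \<psi>) = f (of_real r * v)"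
        by (intro exI[of _ r]) (simp add: f_def r_def)
    qed
    ultimately show ?thesis by blast
  qed
  with 1 2 3 4 show thesis by (rule that)
qed

text \<open>The substitution r = \<open>exp (Re \<zeta>)\<close> turns the sector into the strip and
  the ratio \<open>l\<close> into the translation length \<open>ln l\<close>. The loop
  \<open>\<gamma>\<close> comes from the homotopy description, and lies in \<open>C\<close> because
  it belongs to its own family.\<close>

lemma (in affine_structure) hyperbolic_cylinder_strip:
  assumes "hyperbolic_cylinder X A \<beta> C"
  obtains L F \<gamma> where "hyperbolic_strip X S A \<beta> L F" "F ` strip \<beta> = C"
    "closed_geodesic X A \<gamma>" "range \<gamma> \<subseteq> C" "cylinder_of X A \<gamma> = C"
proof -
  define W :: "(real \<times> real) set" where "W = {0<..} \<times> {0<..<\<beta>}"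
  obtain \<gamma> l \<Phi> where \<beta>: "\<beta> > 0" and \<gamma>: "closed_geodesic X A \<gamma>" "C = cylinder_of X A \<gamma>" and l: "l > 1"
    and \<Phi>: "locally_affine_polar X A W \<Phi>" "\<Phi> ` W = C"
    and \<Phi>_eq: "\<And>x y. x \<in> W \<Longrightarrow> y \<in> W \<Longrightarrow>
      \<Phi> x = \<Phi> y \<longleftrightarrow> (\<exists>k::int. fst y = l powi k * fst x \<and> snd y = snd x)"
    using assms unfolding hyperbolic_cylinder_def W_def by metis
  define h where "h \<zeta> = (exp (Re \<zeta>), Im \<zeta>)" for \<zeta>
  define F where "F \<zeta> = \<Phi> (h \<zeta>)" for \<zeta>
  define L where "L = ln l"
  have h: "h \<zeta> \<in> W" if "\<zeta> \<in> strip \<beta>" for \<zeta> using that by (simp add: h_def W_def strip_iff)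
  have "hyperbolic_strip X S A \<beta> L F"
  proof (unfold_locales)
    show "locally_affine X A exp (strip \<beta>) F" unfolding F_def
    proof (rule locally_affine_compose[OF \<Phi>(1)[unfolded locally_affine_polar_iff] open_strip, where k = 1 and m = 0])
      show "continuous_on (strip \<beta>) h" unfolding h_def by (intro continuous_intros)
    qed (use h in \<open>auto simp: polar_def h_def exp_eq_polar\<close>)
    fix \<zeta> \<zeta>' assume \<zeta>: "\<zeta> \<in> strip \<beta>" "\<zeta>' \<in> strip \<beta>"
    have "exp (Re \<zeta>') = l powi k * exp (Re \<zeta>) \<and> Im \<zeta>' = Im \<zeta> \<longleftrightarrow> \<zeta>' = \<zeta> + of_int k * of_real L" for k :: int
    proof -
      have "l powi k = exp (of_int k * L)" using l exp_power_int[of L k] by (simp add: L_def)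
      then have "l powi k * exp (Re \<zeta>) = exp (of_int k * L + Re \<zeta>)" by (simp add: exp_add)
      then show ?thesis by (auto simp: complex_eq_iff)
    qed
    then show "F \<zeta> = F \<zeta>' \<longleftrightarrow> (\<exists>k::int. \<zeta>' = \<zeta> + of_int k * of_real L)"
      unfolding F_def \<Phi>_eq[OF h[OF \<zeta>(1)] h[OF \<zeta>(2)]] by (simp add: h_def)
  qed (use \<beta> l in \<open>auto simp: L_def\<close>)
  moreover have "F ` strip \<beta> = C"
  proof -
    have "x \<in> h ` strip \<beta>" if "x \<in> W" for x
    proof (rule image_eqI)
      show "x = h (Complex (ln (fst x)) (snd x))" "Complex (ln (fst x)) (snd x) \<in> strip \<beta>"
        using that by (auto simp: h_def W_def strip_iff)
    qed
    then have "h ` strip \<beta> = W" using h by blast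
    then show ?thesis using \<Phi>(2) unfolding F_def by (metis image_image)
  qed
  moreover have "range \<gamma> \<subseteq> C"
  proof -
    have "continuous_map euclideanreal X \<gamma>" using \<gamma>(1) unfolding closed_geodesic_def by blast
    then have "\<gamma> \<in> geodesic_family X A \<gamma>" using \<gamma>(1) by (simp add: geodesic_family_def)
    then show ?thesis unfolding \<gamma>(2) cylinder_of_def by blast
  qed
  ultimately show thesis using that[of L F \<gamma>] \<gamma> by blast
qed

theorem lemma3p1:
  fixes X :: "'a topology" and \<Lambda> :: "'a set" and A :: "'a chart set"
    and C1 C2 :: "'a set" and \<beta>1 \<beta>2 :: real
  assumes "branched_affine_surface X \<Lambda> A"
    and "hyperbolic_cylinder X A \<beta>1 C1" and "\<beta>1 \<ge> pi / 2"
    and "hyperbolic_cylinder X A \<beta>2 C2" and "\<beta>2 \<ge> pi / 2"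
    and "C1 \<noteq> C2"
  shows "C1 \<inter> C2 = {}"
proof (rule ccontr)
  assume "C1 \<inter> C2 \<noteq> {}"
  then obtain x where x: "x \<in> C1" "x \<in> C2" by blast
  have "Hausdorff_space X" "affine_atlas X (topspace X - \<Lambda>) A"
    using assms(1) unfolding branched_affine_surface_def orientable_surface_def by - (elim conjE, assumption)+
  then interpret affine_structure X "topspace X - \<Lambda>" A by (rule affine_structure.intro)
  obtain L1 F1 \<gamma>1 where F1: "hyperbolic_strip X (topspace X - \<Lambda>) A \<beta>1 L1 F1" "F1 ` strip \<beta>1 = C1"
    and \<gamma>1: "closed_geodesic X A \<gamma>1" "range \<gamma>1 \<subseteq> C1" "cylinder_of X A \<gamma>1 = C1"
    using hyperbolic_cylinder_strip[OF assms(2)] by blast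
  obtain L2 F2 \<gamma>2 where F2: "hyperbolic_strip X (topspace X - \<Lambda>) A \<beta>2 L2 F2" "F2 ` strip \<beta>2 = C2"
    and \<gamma>2: "closed_geodesic X A \<gamma>2" "range \<gamma>2 \<subseteq> C2" "cylinder_of X A \<gamma>2 = C2"
    using hyperbolic_cylinder_strip[OF assms(4)] by blast
  interpret S1: hyperbolic_strip X "topspace X - \<Lambda>" A \<beta>1 L1 F1 by (rule F1(1))
  interpret S2: hyperbolic_strip X "topspace X - \<Lambda>" A \<beta>2 L2 F2 by (rule F2(1))
  obtain \<zeta>1 where \<zeta>1: "\<zeta>1 \<in> strip \<beta>1" "F1 \<zeta>1 = x" using x(1) F1(2) by blast
  obtain \<zeta>2 where \<zeta>2: "\<zeta>2 \<in> strip \<beta>2" "F2 \<zeta>2 = x" using x(2) F2(2) by blast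
  obtain f z where f: "dilation_quadrant (exp L1) f" "f ` quadrant \<subseteq> C1" and z: "z \<in> quadrant" "f z = x"
    using S1.quadrant_chart[OF assms(3) \<zeta>1(1)] F1(2) \<zeta>1(2) by metis
  obtain g z' where g: "dilation_quadrant (exp L2) g" "g ` quadrant \<subseteq> C2"
    and z': "z' \<in> quadrant" "g z' = x" and rays: "\<And>v. v \<in> quadrant \<Longrightarrow>
      \<exists>\<gamma>. closed_geodesic X A \<gamma> \<and> (\<forall>t. \<exists>r>0. \<gamma> t = g (of_real r * v))"
    using S2.quadrant_chart[OF assms(5) \<zeta>2(1)] F2(2) \<zeta>2(2) by metis
  obtain \<alpha> p where \<alpha>: "\<alpha> \<noteq> 0" and T: "\<alpha> * (z - p) = z'"
    and fg: "\<And>w. w \<in> quadrant \<Longrightarrow> \<alpha> * (w - p) \<in> quadrant \<Longrightarrow> f w = g (\<alpha> * (w - p))"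
    using dilation_quadrant_transition[OF f(1) g(1) z(1) z'(1)] z(2) z'(2) by metis
  have \<alpha>z: "\<alpha> * (z - p) \<in> quadrant" using T z'(1) by simp
  obtain v where v: "v \<in> quadrant" "\<alpha> * v \<in> quadrant"
    using dilation_quadrant_common_direction[OF f(1) g(1) \<alpha> z(1) \<alpha>z fg] by blast
  obtain \<gamma> where \<gamma>: "closed_geodesic X A \<gamma>" and ray: "\<And>t. \<exists>r>0. \<gamma> t = g (of_real r * (\<alpha> * v))"
    using rays[OF v(2)] by blast
  \<comment> \<open>Membership in \<open>C2\<close> is immediate, \<open>\<gamma>\<close> being a
    ray of \<open>g\<close>; membership in \<open>C1\<close> is what the limit argument
    supplies.\<close>
  have "\<gamma> t \<in> C1 \<inter> C2" for t
  proof -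
    obtain r where r: "r > 0" "\<gamma> t = g (of_real r * (\<alpha> * v))" using ray by blast
    have "g (of_real r * (\<alpha> * v)) \<in> f ` quadrant"
      by (rule dilation_quadrant_limit[OF f(1) g(1) z(1) \<alpha>z fg v r(1)])
    moreover have "of_real r * (\<alpha> * v) \<in> quadrant" using quadrant_cone[OF v(2) r(1)] .
    ultimately show ?thesis using r(2) f(2) g(2) by auto
  qed
  then have ran: "range \<gamma> \<subseteq> C1" "range \<gamma> \<subseteq> C2" by blast+
  have "cylinder_of X A \<gamma>1 = cylinder_of X A \<gamma>"
    by (rule S1.cylinder_of_eq[unfolded F1(2), OF \<gamma>1(1,2) \<gamma> ran(1)])
  moreover have "cylinder_of X A \<gamma>2 = cylinder_of X A \<gamma>"
    by (rule S2.cylinder_of_eq[unfolded F2(2), OF \<gamma>2(1,2) \<gamma> ran(2)])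
  ultimately show False using \<gamma>1(3) \<gamma>2(3) assms(6) by simp
qed

end
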